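(* Let $\Pi$ be the set of all primes. For every $P\subseteq\Pi$, the Fraïssé limit $\mathbb{P}_P$ of $\mathcal{S}_P$ in $\sigma\mathcal{S}_P$ is the $P$-adic pseudo-solenoid.
   Context: Let $\mathbb{S}$ be the unit circle. $\mathcal{S}_P$ is the category with the single object $\mathbb{S}$ whose morphisms are the continuous surjections $f\colon\mathbb{S}\to\mathbb{S}$ with $\deg(f)\in D_P$, where $\deg$ is the degree (winding number) and $D_P$ is the set of all nonzero integers $k$ such that every prime dividing $k$ belongs to $P$. Let $\mathcal{M}$ be the category of all metrizable compacta and all continuous maps. Fix a compatible metric on every metrizable compactum (the choice is irrelevant); hom-sets carry the supremum metric and $f\approx_\varepsilon g$ means $\sup_x d(f(x),g(x))<\varepsilon$. For a subcategory $\mathcal{K}\subseteq\mathcal{M}$, a $\mathcal{K}$-sequence $\langle X_*,f_*\rangle$ consists of $\mathcal{K}$-maps $f_n\colon X_{n+1}\to X_n$, $n\in\omega$; $f_{n,n'}=f_n\circ\cdots\circ f_{n'-1}\colon X_{n'}\to X_n$; its limit in $\mathcal{M}$ is the usual inverse limit $\langle X_\infty,f_{*,\infty}\rangle$ with $f_{n,\infty}\colon X_\infty\to X_n$. The $\sigma$-closure $\sigma\mathcal{K}$ (here taken in $\mathcal{M}$) is the smallest subcategory $\mathcal{L}'\subseteq\mathcal{M}$ such that: $\mathcal{K}\subseteq\mathcal{L}'$; every hom-set $\mathcal{L}'(X,Y)$ is closed in $\mathcal{M}(X,Y)$; $\mathcal{L}'$ contains all the maps $f_{n,\infty}$ of every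 limit cone in $\mathcal{M}$ of every $\mathcal{K}$-sequence; and these remain limits in $\mathcal{L}'$, i.e. if $\langle X_\infty,f_{*,\infty}\rangle$ is a limit in $\mathcal{M}$ of a $\mathcal{K}$-sequence and $h\colon Y\to X_\infty$ is an $\mathcal{M}$-map with $f_{n,\infty}\circ h\in\mathcal{L}'$ for every $n$, then $h\in\mathcal{L}'$. Its objects are exactly the inverse limits of $\mathcal{K}$-sequences. A Fraïssé sequence in $\mathcal{K}$ is a sequence $\langle X_*,f_*\rangle$ that is cofinal (every $\mathcal{K}$-object $Y$ admits a $\mathcal{K}$-map $X_n\to Y$ for some $n$), absorbing (for every $n$, $\varepsilon>0$ and $\mathcal{K}$-map $f\colon Y\to X_n$ there is $n'\ge n$ and a $\mathcal{K}$-map $g\colon X_{n'}\to Y$ with $f\circ g\approx_\varepsilon f_{n,n'}$), and projective (for every $\varepsilon>0$ and $\mathcal{K}$-maps $f\colon X_n\to Z$, $g\colon Y\to Z$ there is $n'\ge n$ and a $\mathcal{K}$-map $g'\colon X_{n'}\to Y$ with $f\circ f_{n,n'}\approx_\varepsilon g\circ g'$). The Fraïssé limit of $\mathcal{K}=\mathcal{S}_P$ in $\mathcal{L}=\sigma\mathcal{S}_P$ is the limit of a Fraïssé sequence in $\mathcal{S}_P$; it exists, is unique up to homeomorphism, and is equivalently the object $U$ of $\sigma\mathcal{S}_P$ such that there is a $\sigma\mathcal{S}_P$-map $U\to\mathbb{S}$ and for all $\sigma\mathcal{S}_P$-maps $f,g\colon U\to\mathbb{S}$ and every $\varepsilon>0$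 there is a homeomorphism $h\colon U\to U$ with $f\approx_\varepsilon g\circ h$. A circle-like continuum is the limit of an inverse sequence of continuous surjections $u_n\colon\mathbb{S}\to\mathbb{S}$. A pseudo-solenoid is a hereditarily indecomposable circle-like continuum, where hereditarily indecomposable means that any two subcontinua are disjoint or comparable by inclusion. Types: if $X$ is the limit of continuous surjections $u_n\colon\mathbb{S}\to\mathbb{S}$ and $\deg(u_n)=0$ for infinitely many $n$, the type of $X$ is $0$; otherwise choose $n_0$ with $\deg(u_n)\ne0$ for all $n\ge n_0$ and let the type of $X$ be the class of the supernatural number $s=\prod_{n\ge n_0}|\deg(u_n)|$, viewed as a function $s\colon\Pi\to\{0,1,2,\dots,\infty\}$ of exponents, under the equivalence: $s\sim s'$ iff $\{p:s(p)=\infty\}=\{p:s'(p)=\infty\}$ and $\{p:s(p)\ne s'(p)\}$ is finite. The type depends only on $X$. For $P\subseteq\Pi$, the $P$-adic pseudo-solenoid is the unique (up to homeomorphism) pseudo-solenoid whose type is the class of $P^\infty=\prod_{p\in P}p^\infty$ (exponent $\infty$ at each $p\in P$ and $0$ at each $p\notin P$). *)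

theory Defs
  imports
    "HOL-Complex_Analysis.Complex_Analysis"
    "HOL-Computational_Algebra.Primes"
    "HOL-Library.Extended_Nat"
begin

section \<open>Categories of metrizable compacta\<close>

text \<open>
  A metrizable compactum has at most continuum many points, so up to homeomorphism its set of points
  may be taken to be a set of complex numbers. The objects of the ambient category are therefore
  all values of type \<^typ>\<open>complex topology\<close> that are compact and metrizable; such a topology lives
  on an arbitrary subset of the complex plane and need not be its subspace topology.

  An arrow is a triple (domain, map, codomain), whose map is undefined outside the
  domain. A subcategory is given by its set of arrows; its objects are those
  whose identity arrow belongs to it.
\<close>

type_synonym arrow = "complex topology \<times> (complex \<Rightarrow> complex) \<times> complex topology"

type_synonym cat = "arrow set"

definition metrizable_compacta :: cat where
  "metrizable_compacta =
     {(X, f, Y). compact_space X \<and> metrizable_space X \<and> compact_space Y \<and> metrizable_space Y \<and>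
                 continuous_map X Y f \<and> f \<in> extensional (topspace X)}"

definition id_map :: "complex topology \<Rightarrow> complex \<Rightarrow> complex" where
  "id_map X = restrict id (topspace X)"

definition cat_obj :: "cat \<Rightarrow> complex topology set" where
  "cat_obj L = {X. (X, id_map X, X) \<in> L}"

definition cat_hom :: "cat \<Rightarrow> complex topology \<Rightarrow> complex topology \<Rightarrow> (complex \<Rightarrow> complex) set" where
  "cat_hom L X Y = {f. (X, f, Y) \<in> L}"

definition subcategory :: "cat \<Rightarrow> bool" where
  "subcategory L \<longleftrightarrow>
     L \<subseteq> metrizable_compacta \<and>
     (\<forall>X f Y. (X, f, Y) \<in> L \<longrightarrow> X \<in> cat_obj L \<and> Y \<in> cat_obj L) \<and>
     (\<forall>X f Y g Z. (X, f, Y) \<in> L \<longrightarrow> (Y, g, Z) \<in> L \<longrightarrow> (X, compose (topspace X) g f, Z) \<in> L)"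

text \<open>The fixed compatible metric, and the supremum metric on the maps between two compacta.\<close>

definition fixed_metric :: "complex topology \<Rightarrow> complex metric" where
  "fixed_metric Y = (SOME m. mtopology_of m = Y)"

definition hom_metric :: "complex topology \<Rightarrow> complex topology \<Rightarrow> (complex \<Rightarrow> complex) metric" where
  "hom_metric X Y = cfunspace X (fixed_metric Y)"

definition approx_maps ::
    "complex topology \<Rightarrow> complex topology \<Rightarrow> real \<Rightarrow> (complex \<Rightarrow> complex) \<Rightarrow> (complex \<Rightarrow> complex) \<Rightarrow> bool" where
  "approx_maps X Y \<epsilon> f g \<longleftrightarrow> mdist (hom_metric X Y) f g < \<epsilon>"

section \<open>Inverse sequences and limits\<close>

definition cat_seq :: "cat \<Rightarrow> (nat \<Rightarrow> complex topology) \<Rightarrow> (nat \<Rightarrow> complex \<Rightarrow> complex) \<Rightarrow> bool" where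
  "cat_seq K X f \<longleftrightarrow> (\<forall>n. (X (Suc n), f n, X n) \<in> K)"

text \<open>\<open>bond X f n m\<close> is the composition of the maps with indices \<open>n, \<dots>, m - 1\<close>, from \<open>X m\<close> to \<open>X n\<close>;
  it is meant for \<open>n \<le> m\<close> only.\<close>

primrec bond ::
    "(nat \<Rightarrow> complex topology) \<Rightarrow> (nat \<Rightarrow> complex \<Rightarrow> complex) \<Rightarrow> nat \<Rightarrow> nat \<Rightarrow> complex \<Rightarrow> complex" where
  "bond X f n 0 = id_map (X 0)"
| "bond X f n (Suc m) =
     (if n \<le> m then compose (topspace (X (Suc m))) (bond X f n m) (f m) else id_map (X (Suc m)))"

definition cone_over ::
    "cat \<Rightarrow> (nat \<Rightarrow> complex topology) \<Rightarrow> (nat \<Rightarrow> complex \<Rightarrow> complex) \<Rightarrow>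
     complex topology \<Rightarrow> (nat \<Rightarrow> complex \<Rightarrow> complex) \<Rightarrow> bool" where
  "cone_over C X f U p \<longleftrightarrow>
     (\<forall>n. (U, p n, X n) \<in> C) \<and> (\<forall>n. p n = compose (topspace U) (f n) (p (Suc n)))"

definition limit_cone ::
    "cat \<Rightarrow> (nat \<Rightarrow> complex topology) \<Rightarrow> (nat \<Rightarrow> complex \<Rightarrow> complex) \<Rightarrow>
     complex topology \<Rightarrow> (nat \<Rightarrow> complex \<Rightarrow> complex) \<Rightarrow> bool" where
  "limit_cone C X f U p \<longleftrightarrow>
     cone_over C X f U p \<and>
     (\<forall>Y q. cone_over C X f Y q \<longrightarrow>
        (\<exists>!h. (Y, h, U) \<in> C \<and> (\<forall>n. compose (topspace Y) (p n) h = q n)))"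

section \<open>The sigma-closure\<close>

definition sigma_admissible :: "cat \<Rightarrow> cat \<Rightarrow> bool" where
  "sigma_admissible K L \<longleftrightarrow>
     subcategory L \<and> K \<subseteq> L \<and>
     (\<forall>X \<in> cat_obj L. \<forall>Y \<in> cat_obj L. closedin (mtopology_of (hom_metric X Y)) (cat_hom L X Y)) \<and>
     (\<forall>X f U p. cat_seq K X f \<longrightarrow> limit_cone metrizable_compacta X f U p \<longrightarrow>
        (\<forall>n. (U, p n, X n) \<in> L) \<and>
        (\<forall>Y h. (Y, h, U) \<in> metrizable_compacta \<longrightarrow>
           (\<forall>n. (Y, compose (topspace Y) (p n) h, X n) \<in> L) \<longrightarrow> (Y, h, U) \<in> L))"

text \<open>All clauses above are preserved by intersections, so this is the smallest admissible subcategory.\<close>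

definition sigma_closure :: "cat \<Rightarrow> cat" where
  "sigma_closure K = \<Inter>{L. sigma_admissible K L}"

section \<open>Fraisse sequences and Fraisse limits\<close>

definition fraisse_cofinal :: "cat \<Rightarrow> (nat \<Rightarrow> complex topology) \<Rightarrow> bool" where
  "fraisse_cofinal K X \<longleftrightarrow> (\<forall>Y \<in> cat_obj K. \<exists>n g. (X n, g, Y) \<in> K)"

definition fraisse_absorbing ::
    "cat \<Rightarrow> (nat \<Rightarrow> complex topology) \<Rightarrow> (nat \<Rightarrow> complex \<Rightarrow> complex) \<Rightarrow> bool" where
  "fraisse_absorbing K X f \<longleftrightarrow>
     (\<forall>n. \<forall>\<epsilon>>0. \<forall>Y g. (Y, g, X n) \<in> K \<longrightarrow>
        (\<exists>m\<ge>n. \<exists>h. (X m, h, Y) \<in> K \<and>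
           approx_maps (X m) (X n) \<epsilon> (compose (topspace (X m)) g h) (bond X f n m)))"

definition fraisse_projective ::
    "cat \<Rightarrow> (nat \<Rightarrow> complex topology) \<Rightarrow> (nat \<Rightarrow> complex \<Rightarrow> complex) \<Rightarrow> bool" where
  "fraisse_projective K X f \<longleftrightarrow>
     (\<forall>n. \<forall>\<epsilon>>0. \<forall>Y Z a b. (X n, a, Z) \<in> K \<longrightarrow> (Y, b, Z) \<in> K \<longrightarrow>
        (\<exists>m\<ge>n. \<exists>c. (X m, c, Y) \<in> K \<and>
           approx_maps (X m) Z \<epsilon>
             (compose (topspace (X m)) a (bond X f n m)) (compose (topspace (X m)) b c)))"

definition fraisse_sequence ::
    "cat \<Rightarrow> (nat \<Rightarrow> complex topology) \<Rightarrow> (nat \<Rightarrow> complex \<Rightarrow> complex) \<Rightarrow> bool" where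
  "fraisse_sequence K X f \<longleftrightarrow>
     cat_seq K X f \<and> fraisse_cofinal K X \<and> fraisse_absorbing K X f \<and> fraisse_projective K X f"

definition fraisse_limit :: "cat \<Rightarrow> cat \<Rightarrow> complex topology \<Rightarrow> bool" where
  "fraisse_limit K L U \<longleftrightarrow> (\<exists>X f p. fraisse_sequence K X f \<and> limit_cone L X f U p)"

section \<open>Circle maps and the category of the circle\<close>

definition circle :: "complex topology" where
  "circle = top_of_set (sphere 0 1)"

definition circle_surjection :: "(complex \<Rightarrow> complex) \<Rightarrow> bool" where
  "circle_surjection f \<longleftrightarrow>
     continuous_map circle circle f \<and> f ` topspace circle = topspace circle"

definition circle_degree :: "(complex \<Rightarrow> complex) \<Rightarrow> int" where
  "circle_degree f = (THE k. winding_number (f \<circ> circlepath 0 1) 0 = of_int k)"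

definition degree_set :: "nat set \<Rightarrow> int set" where
  "degree_set P = {k. k \<noteq> 0 \<and> (\<forall>p::nat. prime p \<longrightarrow> int p dvd k \<longrightarrow> p \<in> P)}"

definition circle_cat :: "nat set \<Rightarrow> cat" where
  "circle_cat P =
     {(circle, f, circle) |f. f \<in> extensional (topspace circle) \<and> circle_surjection f \<and>
                              circle_degree f \<in> degree_set P}"

section \<open>Circle-like continua, their types, and pseudo-solenoids\<close>

definition inverse_limit :: "(nat \<Rightarrow> 'a topology) \<Rightarrow> (nat \<Rightarrow> 'a \<Rightarrow> 'a) \<Rightarrow> (nat \<Rightarrow> 'a) topology" where
  "inverse_limit X f = subtopology (product_topology X UNIV) {x. \<forall>n. x n = f n (x (Suc n))}"

definition circle_expansion :: "'a topology \<Rightarrow> (nat \<Rightarrow> complex \<Rightarrow> complex) \<Rightarrow> bool" where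
  "circle_expansion X u \<longleftrightarrow>
     (\<forall>n. circle_surjection (u n)) \<and> X homeomorphic_space inverse_limit (\<lambda>_. circle) u"

definition circle_like :: "'a topology \<Rightarrow> bool" where
  "circle_like X \<longleftrightarrow> (\<exists>u. circle_expansion X u)"

definition subcontinuum :: "'a topology \<Rightarrow> 'a set \<Rightarrow> bool" where
  "subcontinuum X C \<longleftrightarrow> C \<noteq> {} \<and> compactin X C \<and> connectedin X C"

definition hereditarily_indecomposable :: "'a topology \<Rightarrow> bool" where
  "hereditarily_indecomposable X \<longleftrightarrow>
     (\<forall>C D. subcontinuum X C \<longrightarrow> subcontinuum X D \<longrightarrow> C \<inter> D = {} \<or> C \<subseteq> D \<or> D \<subseteq> C)"

definition pseudo_solenoid :: "'a topology \<Rightarrow> bool" where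
  "pseudo_solenoid X \<longleftrightarrow> circle_like X \<and> hereditarily_indecomposable X"

text \<open>A supernatural number is given by its exponents; the values at non-primes are irrelevant,
  because the equivalence relation ignores them.\<close>

type_synonym supernatural = "nat \<Rightarrow> enat"

definition supernatural_equiv :: "supernatural \<Rightarrow> supernatural \<Rightarrow> bool" where
  "supernatural_equiv s s' \<longleftrightarrow>
     {p. prime p \<and> s p = \<infinity>} = {p. prime p \<and> s' p = \<infinity>} \<and> finite {p. prime p \<and> s p \<noteq> s' p}"

definition supernatural_class :: "supernatural \<Rightarrow> supernatural set" where
  "supernatural_class s = {s'. supernatural_equiv s s'}"

definition degree_product :: "(nat \<Rightarrow> complex \<Rightarrow> complex) \<Rightarrow> nat \<Rightarrow> supernatural" where
  "degree_product u n0 =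
     (\<lambda>p. SUP N. \<Sum>n\<in>{n0..<N}. enat (multiplicity p (nat \<bar>circle_degree (u n)\<bar>)))"

datatype continuum_type = Zero_Type | Class_Type "supernatural set"

definition sequence_type :: "(nat \<Rightarrow> complex \<Rightarrow> complex) \<Rightarrow> continuum_type" where
  "sequence_type u =
     (if infinite {n. circle_degree (u n) = 0} then Zero_Type
      else Class_Type (supernatural_class
             (degree_product u (SOME n0. \<forall>n\<ge>n0. circle_degree (u n) \<noteq> 0))))"

text \<open>The type does not depend on the chosen expansion, so it may be read off from any one of them.\<close>

definition has_type :: "'a topology \<Rightarrow> continuum_type \<Rightarrow> bool" where
  "has_type X \<tau> \<longleftrightarrow> (\<exists>u. circle_expansion X u \<and> sequence_type u = \<tau>)"

definition prime_power_infinity :: "nat set \<Rightarrow> supernatural" where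
  "prime_power_infinity P = (\<lambda>p. if p \<in> P then \<infinity> else 0)"

text \<open>This determines the space up to homeomorphism, which justifies speaking of the P-adic
  pseudo-solenoid.\<close>

definition adic_pseudo_solenoid :: "nat set \<Rightarrow> 'a topology \<Rightarrow> bool" where
  "adic_pseudo_solenoid P X \<longleftrightarrow>
     pseudo_solenoid X \<and> has_type X (Class_Type (supernatural_class (prime_power_infinity P)))"

end

theory Submission
  imports Defs
begin

text \<open>
  Because a Fraisse sequence absorbs the power map of exponent \<open>p \<in> P\<close>, the degree of some
  composition of bonding maps after any given index is divisible by \<open>p\<close>, so the exponent of \<open>p\<close>
  in the type is infinite; exponents at other primes vanish because the degrees lie in \<open>degree_set P\<close>.

  For hereditary indecomposability, let subcontinua \<open>C\<close> and \<open>D\<close> of the limit contain points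
  \<open>c \<notin> D\<close> and \<open>d \<notin> C\<close>. At some index \<open>n\<close> the projection \<open>a\<close> of \<open>c\<close> misses that of \<open>D\<close>, and
  the projection \<open>b\<close> of \<open>d\<close> misses that of \<open>C\<close>. A map \<open>g\<close> of degree one folds the two arcs
  between \<open>a\<close> and \<open>b\<close> so that the points with real part \<open>1/2\<close> go close to \<open>b\<close>, those with real
  part \<open>-1/2\<close> go close to \<open>a\<close>, and \<open>a\<close> and \<open>b\<close> are approached only on the two outer sides.
  Absorbing \<open>g\<close> as \<open>g \<circ> h\<close>, the real part of \<open>h\<close> never takes the value \<open>1/2\<close> on \<open>C\<close> nor \<open>-1/2\<close>
  on \<open>D\<close>, hence by connectedness exceeds \<open>1/2\<close> on \<open>C\<close> and is below \<open>-1/2\<close> on \<open>D\<close>: the two are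
  disjoint.

  The limit in the sigma-closure is the inverse limit, because a copy of the inverse limit on a
  set of complex numbers is a limit in \<open>metrizable_compacta\<close>, and such limits persist in the closure.
\<close>

section \<open>Limits in the sigma-closure\<close>

lemma metrizable_compactaI:
  assumes "compact_space X" "metrizable_space X" "compact_space Y" "metrizable_space Y"
    "continuous_map X Y f" "f \<in> extensional (topspace X)"
  shows "(X, f, Y) \<in> metrizable_compacta"
  using assms by (simp add: metrizable_compacta_def)

lemma compact_space_circle: "compact_space circle"
  unfolding circle_def by (intro compact_space_subtopology) simp

lemma id_map_apply: "x \<in> topspace X \<Longrightarrow> id_map X x = x"
  by (simp add: id_map_def)

lemma continuous_map_id_map: "continuous_map X X (id_map X)"
  by (metis continuous_map_eq continuous_map_id id_apply id_map_apply)

lemma continuous_map_compose_restrict: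
  "continuous_map X Y f \<Longrightarrow> continuous_map Y Z g \<Longrightarrow> continuous_map X Z (compose (topspace X) g f)"
  by (erule (1) continuous_map_eq[OF continuous_map_compose]) (simp add: compose_def)

lemma cat_obj_metrizable_compacta:
  "X \<in> cat_obj metrizable_compacta \<longleftrightarrow> compact_space X \<and> metrizable_space X"
  by (auto simp: cat_obj_def metrizable_compacta_def continuous_map_id_map id_map_def)

lemma subcategory_metrizable_compacta: "subcategory metrizable_compacta"
  unfolding subcategory_def cat_obj_metrizable_compacta
  by (auto simp: metrizable_compacta_def continuous_map_compose_restrict)

section \<open>Hom-sets as metric spaces of maps\<close>

lemma mtopology_of_fixed_metric:
  assumes "metrizable_space Y"
  shows "mtopology_of (fixed_metric Y) = Y"
proof -
  have "\<exists>m. mtopology_of m = Y"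
    using assms by (metis Metric_space.mtopology_of metrizable_space_def)
  then show ?thesis
    unfolding fixed_metric_def by (rule someI_ex)
qed

text \<open>Continuous images of compacta are bounded, so the boundedness built into
  \<open>cfunspace\<close> excludes no continuous map.\<close>

lemma mspace_hom_metric:
  assumes "compact_space X" "compact_space Y" "metrizable_space Y"
  shows "mspace (hom_metric X Y) = {f. continuous_map X Y f \<and> f \<in> extensional (topspace X)}"
proof -
  let ?m = "fixed_metric Y"
  have Y: "mtopology_of ?m = Y" by (simp add: assms mtopology_of_fixed_metric)
  then have sp: "mspace ?m = topspace Y" by (metis topspace_mtopology_of)
  have "Metric_space.mbounded (mspace ?m) (mdist ?m) (f ` topspace X)" if "continuous_map X Y f" for f
  proof -
    have "compactin Y (f ` topspace X)"
      using that assms(1) by (simp add: compact_space_def image_compactin)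
    then have "compactin (Metric_space.mtopology (mspace ?m) (mdist ?m)) (f ` topspace X)"
      using Y by (simp add: mtopology_of_def)
    then show ?thesis
      using Metric_space.compactin_imp_mbounded[OF Metric_space_mspace_mdist] by blast
  qed
  then show ?thesis
    unfolding hom_metric_def using Y sp
    by (auto simp: continuous_map_def)
qed

lemma cat_hom_metrizable_compacta:
  assumes "compact_space X" "metrizable_space X" "compact_space Y" "metrizable_space Y"
  shows "cat_hom metrizable_compacta X Y = mspace (hom_metric X Y)"
  unfolding mspace_hom_metric[OF assms(1,3,4)]
  using assms by (auto simp: cat_hom_def metrizable_compacta_def)

text \<open>Each hom-set of the ambient category is the whole space of maps, hence closed. This puts
  the ambient category into the family whose intersection is \<open>sigma_closure K\<close>.\<close>

lemma sigma_admissible_metrizable_compacta: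
  assumes "K \<subseteq> metrizable_compacta"
  shows "sigma_admissible K metrizable_compacta"
  unfolding sigma_admissible_def
proof (intro conjI ballI allI impI)
  show "subcategory metrizable_compacta" by (rule subcategory_metrizable_compacta)
  show "K \<subseteq> metrizable_compacta" by (rule assms)
  show "closedin (mtopology_of (hom_metric X Y)) (cat_hom metrizable_compacta X Y)"
    if "X \<in> cat_obj metrizable_compacta" "Y \<in> cat_obj metrizable_compacta" for X Y
    using that
    by (simp add: cat_obj_metrizable_compacta cat_hom_metrizable_compacta
        flip: topspace_mtopology_of)
  show "(U, p n, X n) \<in> metrizable_compacta"
    if "limit_cone metrizable_compacta X f U p" for X f U p n
    using that unfolding limit_cone_def cone_over_def by blast
qed

section \<open>Persistence of limits in the closure and their uniqueness there\<close>

lemma sigma_closure_subset: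
  "K \<subseteq> metrizable_compacta \<Longrightarrow> sigma_closure K \<subseteq> metrizable_compacta"
  unfolding sigma_closure_def using sigma_admissible_metrizable_compacta by blast

lemma sigma_closure_id:
  assumes "(X, f, Y) \<in> sigma_closure K"
  shows "(X, id_map X, X) \<in> sigma_closure K"
proof -
  have "(X, id_map X, X) \<in> L" if L: "sigma_admissible K L" for L
  proof -
    have "subcategory L" using L by (simp add: sigma_admissible_def)
    moreover have "(X, f, Y) \<in> L" using assms L by (simp add: sigma_closure_def)
    ultimately show ?thesis unfolding subcategory_def cat_obj_def by blast
  qed
  then show ?thesis by (simp add: sigma_closure_def)
qed

lemma sigma_closure_compose:
  assumes "(X, f, Y) \<in> sigma_closure K" "(Y, g, Z) \<in> sigma_closure K"
  shows "(X, compose (topspace X) g f, Z) \<in> sigma_closure K"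
proof -
  have "(X, compose (topspace X) g f, Z) \<in> L" if L: "sigma_admissible K L" for L
  proof -
    have "subcategory L" using L by (simp add: sigma_admissible_def)
    moreover have "(X, f, Y) \<in> L" "(Y, g, Z) \<in> L" using assms L by (simp_all add: sigma_closure_def)
    ultimately show ?thesis unfolding subcategory_def by simp
  qed
  then show ?thesis by (simp add: sigma_closure_def)
qed

text \<open>Uniqueness of the mediating arrow is inherited from the larger ambient category; its
  membership in the closure is what the last clause of \<open>sigma_admissible\<close>
  provides.\<close>

lemma limit_cone_sigma_closure:
  assumes K: "K \<subseteq> metrizable_compacta" and seq: "cat_seq K X f"
    and lim: "limit_cone metrizable_compacta X f U p"
  shows "limit_cone (sigma_closure K) X f U p"
proof -
  have "(U, p n, X n) \<in> sigma_closure K" for n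
    using seq lim unfolding sigma_closure_def sigma_admissible_def by blast
  then have cone: "cone_over (sigma_closure K) X f U p"
    using lim unfolding limit_cone_def cone_over_def by blast
  have "\<exists>!h. (Y, h, U) \<in> sigma_closure K \<and> (\<forall>n. compose (topspace Y) (p n) h = q n)"
    if q: "cone_over (sigma_closure K) X f Y q" for Y q
  proof -
    have "cone_over metrizable_compacta X f Y q"
      using q sigma_closure_subset[OF K] unfolding cone_over_def by blast
    then obtain h where h: "(Y, h, U) \<in> metrizable_compacta" "\<And>n. compose (topspace Y) (p n) h = q n"
      and uniq: "\<And>h'. (Y, h', U) \<in> metrizable_compacta \<Longrightarrow>
                   (\<And>n. compose (topspace Y) (p n) h' = q n) \<Longrightarrow> h' = h"
      using lim unfolding limit_cone_def by metis
    \<comment> \<open>The clause applies in each admissible \<open>L\<close> separately, and the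
      closure is their intersection.\<close>
    have "(Y, h, U) \<in> L" if L: "sigma_admissible K L" for L
    proof -
      have "(Y, compose (topspace Y) (p n) h, X n) \<in> L" for n
      proof -
        have "(Y, q n, X n) \<in> sigma_closure K" using q unfolding cone_over_def by blast
        then show ?thesis using h(2)[of n] L by (simp add: sigma_closure_def)
      qed
      then show ?thesis
        using L seq lim h(1) unfolding sigma_admissible_def by blast
    qed
    then have "(Y, h, U) \<in> sigma_closure K"
      by (simp add: sigma_closure_def)
    then show ?thesis
      using h(2) uniq sigma_closure_subset[OF K] by blast
  qed
  with cone show ?thesis
    by (simp add: limit_cone_def)
qed

lemma metrizable_compacta_image:
  "(Y, h, U) \<in> metrizable_compacta \<Longrightarrow> x \<in> topspace Y \<Longrightarrow> h x \<in> topspace U"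
  by (auto simp: metrizable_compacta_def continuous_map_def)

text \<open>The mediating arrows between two limits are mutually inverse; being continuous, they
  form a homeomorphism.\<close>

lemma limit_cones_homeomorphic:
  assumes K: "K \<subseteq> metrizable_compacta"
    and U: "limit_cone (sigma_closure K) X f U p" and V: "limit_cone (sigma_closure K) X f V q"
  shows "U homeomorphic_space V"
proof -
  let ?L = "sigma_closure K"
  have L: "?L \<subseteq> metrizable_compacta" by (rule sigma_closure_subset[OF K])
  have arr: "\<exists>h. (A, h, B) \<in> ?L \<and> (\<forall>n. compose (topspace A) (s n) h = r n)"
    if "limit_cone ?L X f A r" "limit_cone ?L X f B s" for A B r s
    using that unfolding limit_cone_def by blast
  have inv: "k (h x) = x"
    if A: "limit_cone ?L X f A r" and h: "(A, h, B) \<in> ?L" "\<And>n. compose (topspace A) (s n) h = r n"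
      and k: "(B, k, A) \<in> ?L" "\<And>n. compose (topspace B) (r n) k = s n" and x: "x \<in> topspace A"
    for A B r s h k x
  proof -
    have c: "cone_over ?L X f A r" using A by (simp add: limit_cone_def)
    have hB: "h y \<in> topspace B" if "y \<in> topspace A" for y
      using h(1) L that by (auto intro: metrizable_compacta_image)
    have "compose (topspace A) (r n) (compose (topspace A) k h) = r n" for n
    proof -
      have "compose (topspace A) (r n) (compose (topspace A) k h)
          = compose (topspace A) (compose (topspace B) (r n) k) h"
        using hB by (auto simp: compose_def)
      then show ?thesis by (simp add: k(2) h(2))
    qed
    moreover have "compose (topspace A) (r n) (id_map A) = r n" for n
    proof -
      have "(A, r n, X n) \<in> metrizable_compacta" using c L unfolding cone_over_def by blast
      then have "r n \<in> extensional (topspace A)" by (simp add: metrizable_compacta_def)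
      then show ?thesis
        by (intro extensionalityI[OF compose_extensional]) (auto simp: compose_eq id_map_apply)
    qed
    moreover have "(A, compose (topspace A) k h, A) \<in> ?L"
      using h(1) k(1) by (rule sigma_closure_compose)
    moreover have "(A, id_map A, A) \<in> ?L" using h(1) by (rule sigma_closure_id)
    \<comment> \<open>Both endomaps of \<open>A\<close> mediate from the cone \<open>r\<close> to
      itself.\<close>
    ultimately have "compose (topspace A) k h = id_map A"
      using A c unfolding limit_cone_def by blast
    then show ?thesis using x by (metis compose_eq id_map_apply)
  qed
  obtain h where h: "(U, h, V) \<in> ?L" "\<And>n. compose (topspace U) (q n) h = p n"
    using arr[OF U V] by blast
  obtain k where k: "(V, k, U) \<in> ?L" "\<And>n. compose (topspace V) (p n) k = q n"
    using arr[OF V U] by blast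
  have "homeomorphic_maps U V h k"
    using h k L inv[OF U h k] inv[OF V k h]
    by (auto simp: homeomorphic_maps_def metrizable_compacta_def)
  then show ?thesis
    by (auto simp: homeomorphic_space_def)
qed

section \<open>Realizing the inverse limit on a set of complex numbers\<close>

lemma sequences_inject_complex: "\<exists>j :: (nat \<Rightarrow> complex) \<Rightarrow> complex. inj j"
proof -
  obtain r :: "real \<Rightarrow> nat set" and s :: "nat set \<Rightarrow> real" where r: "bij r" and s: "bij s"
    using nat_sets_eqpoll_reals eqpoll_sym unfolding eqpoll_def by meson
  \<comment> \<open>All real and imaginary parts, turned into sets of naturals by \<open>r\<close>,
    are stored in one set: even second components serve the real parts, odd ones the imaginary
    parts.\<close>
  define code where "code x = {i. case prod_decode i of (n, k) \<Rightarrow>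
      (if even k then k div 2 \<in> r (Re (x n)) else k div 2 \<in> r (Im (x n)))}" for x :: "nat \<Rightarrow> complex"
  have mem: "prod_encode (n, 2 * k) \<in> code x \<longleftrightarrow> k \<in> r (Re (x n))"
    "prod_encode (n, Suc (2 * k)) \<in> code x \<longleftrightarrow> k \<in> r (Im (x n))" for x n k
    by (auto simp: code_def)
  have "inj code"
  proof (rule injI, rule ext)
    fix x y n assume "code x = code y"
    then have "r (Re (x n)) = r (Re (y n))" "r (Im (x n)) = r (Im (y n))"
      using mem by blast+
    then show "x n = y n"
      using r by (simp add: bij_def inj_eq complex_eq_iff)
  qed
  then have "inj (\<lambda>x. complex_of_real (s (code x)))"
    using s by (auto simp: inj_def bij_def)
  then show ?thesis by blast
qed

text \<open>Carries a space over to another carrier type, as needed to turn a space of sequences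
  into one of complex numbers.\<close>

lemma homeomorphic_maps_pullback_topology:
  assumes "inj j"
  shows "homeomorphic_maps (pullback_topology (range j) (inv j) T) T (inv j) j"
  unfolding homeomorphic_maps_def
proof (intro conjI ballI)
  show "continuous_map (pullback_topology (range j) (inv j) T) T (inv j)"
    using continuous_map_pullback[of T T id "range j" "inv j"] by simp
  show "continuous_map T (pullback_topology (range j) (inv j) T) j"
    by (rule continuous_map_pullback') (use assms in \<open>auto simp: o_def continuous_map_id[unfolded id_def]\<close>)
qed (use assms in \<open>auto simp: topspace_pullback_topology\<close>)

lemma topspace_inverse_limit:
  "topspace (inverse_limit X f) =
     {x. (\<forall>n. x n \<in> topspace (X n)) \<and> (\<forall>n. x n = f n (x (Suc n)))}"
  unfolding inverse_limit_def topspace_subtopology topspace_product_topology PiE_UNIV_domain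
  by blast

lemma continuous_map_inverse_limit_projection:
  "continuous_map (inverse_limit X f) (X n) (\<lambda>x. x n)"
  unfolding inverse_limit_def
  by (intro continuous_map_from_subtopology continuous_map_product_projection) simp

text \<open>Each bonding condition is an equalizer of continuous maps into a Hausdorff space, so the
  threads form a closed subset of the compact product.\<close>

lemma compact_space_inverse_limit:
  assumes comp: "\<And>n. compact_space (X n)" and haus: "\<And>n. Hausdorff_space (X n)"
    and f: "\<And>n. continuous_map (X (Suc n)) (X n) (f n)"
  shows "compact_space (inverse_limit X f)"
proof -
  let ?T = "inverse_limit X f"
  let ?P = "product_topology X UNIV"
  have proj: "continuous_map ?P (X n) (\<lambda>x. x n)" for n
    by (simp add: continuous_map_product_projection)
  have "closedin ?P {x \<in> topspace ?P. x n = f n (x (Suc n))}" for n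
  proof (rule closedin_continuous_maps_eq[OF haus proj])
    show "continuous_map ?P (X n) (\<lambda>x. f n (x (Suc n)))"
      using continuous_map_compose[OF proj f] by (simp add: o_def)
  qed
  then have "closedin ?P (\<Inter>n. {x \<in> topspace ?P. x n = f n (x (Suc n))})"
    by (intro closedin_Inter) blast+
  moreover have "(\<Inter>n. {x \<in> topspace ?P. x n = f n (x (Suc n))}) = topspace ?T"
    unfolding topspace_inverse_limit topspace_product_topology PiE_UNIV_domain by blast
  ultimately have "closedin ?P (topspace ?T)" by simp
  moreover have "compact_space ?P" by (simp add: compact_space_product_topology comp)
  ultimately have "compactin ?P (topspace ?T)" by (simp add: closedin_compact_space)
  moreover have "?T = subtopology ?P (topspace ?T)"
    unfolding inverse_limit_def topspace_subtopology by (rule subtopology_restrict[symmetric])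
  ultimately show ?thesis
    by (metis compact_space_subtopology)
qed

text \<open>Threads have the wrong type for points of an object, so \<open>V\<close> copies them
  along an injection \<open>j\<close>; the projections are the coordinates after decoding by
  \<open>inv j\<close>.\<close>

lemma limit_cone_exists:
  assumes comp: "\<And>n. compact_space (X n)" and metr: "\<And>n. metrizable_space (X n)"
    and f: "\<And>n. continuous_map (X (Suc n)) (X n) (f n)"
  shows "\<exists>V q. limit_cone metrizable_compacta X f V q \<and> V homeomorphic_space inverse_limit X f"
proof -
  let ?T = "inverse_limit X f"
  let ?P = "product_topology X UNIV"
  have haus: "Hausdorff_space (X n)" for n
    by (simp add: metr metrizable_imp_Hausdorff_space)
  note topT = topspace_inverse_limit[of X f]
  have compT: "compact_space ?T"
    by (intro compact_space_inverse_limit comp haus f)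
  have metrT: "metrizable_space ?T"
    unfolding inverse_limit_def
    by (rule metrizable_space_subtopology) (simp add: metrizable_space_product_topology metr)
  obtain j :: "(nat \<Rightarrow> complex) \<Rightarrow> complex" where j: "inj j"
    using sequences_inject_complex by blast
  define V where "V = pullback_topology (range j) (inv j) ?T"
  have hom: "homeomorphic_maps V ?T (inv j) j"
    unfolding V_def by (rule homeomorphic_maps_pullback_topology[OF j])
  then have homeo: "V homeomorphic_space ?T"
    by (auto simp: homeomorphic_space_def)
  have V: "compact_space V" "metrizable_space V"
    using compT metrT homeomorphic_compact_space[OF homeo] homeomorphic_metrizable_space[OF homeo]
    by auto
  define q where "q n = restrict (\<lambda>v. inv j v n) (topspace V)" for n
  have ij: "continuous_map V ?T (inv j)" and jc: "continuous_map ?T V j"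
    using hom by (auto simp: homeomorphic_maps_def)
  have q_cont: "continuous_map V (X n) (q n)" for n
    by (rule continuous_map_eq[OF continuous_map_compose[OF ij continuous_map_inverse_limit_projection]]) (auto simp: q_def)
  have vT: "inv j v \<in> topspace ?T" if "v \<in> topspace V" for v
    using ij that by (auto simp: continuous_map_def)
  have v_thread: "inv j v n = f n (inv j v (Suc n))" if "v \<in> topspace V" for v n
    using vT[OF that] unfolding topT by blast
  have cone: "cone_over metrizable_compacta X f V q"
    unfolding cone_over_def
  proof (intro conjI allI)
    show "(V, q n, X n) \<in> metrizable_compacta" for n
      by (intro metrizable_compactaI V comp metr q_cont) (simp add: q_def)
    show "q n = compose (topspace V) (f n) (q (Suc n))" for n
    proof
      fix v
      show "q n v = compose (topspace V) (f n) (q (Suc n)) v"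
        using v_thread[of v n] by (auto simp: q_def compose_def)
    qed
  qed
  have "\<exists>!h. (Y, h, V) \<in> metrizable_compacta \<and> (\<forall>n. compose (topspace Y) (q n) h = r n)"
    if r: "cone_over metrizable_compacta X f Y r" for Y r
  proof (rule ex1I)
    have rM: "(Y, r n, X n) \<in> metrizable_compacta" and rr: "r n = compose (topspace Y) (f n) (r (Suc n))" for n
      using r unfolding cone_over_def by blast+
    from rM have Y: "compact_space Y" "metrizable_space Y"
      and rc: "\<And>n. continuous_map Y (X n) (r n)" and rE: "\<And>n. r n \<in> extensional (topspace Y)"
      by (auto simp: metrizable_compacta_def)
    \<comment> \<open>The values of the cone at \<open>y\<close> form a thread, whose code is the
      only possible image of \<open>y\<close>.\<close>
    define h where "h = restrict (\<lambda>y. j (\<lambda>n. r n y)) (topspace Y)"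
    have "(\<lambda>n. r n y) \<in> topspace ?T" if y: "y \<in> topspace Y" for y
    proof -
      have "r n y \<in> topspace (X n)" for n
        using rc y by (auto simp: continuous_map_def)
      moreover have "r n y = f n (r (Suc n) y)" for n
        using rr[of n] compose_eq[OF y] by metis
      ultimately show ?thesis
        unfolding topT by blast
    qed
    moreover have "continuous_map Y ?P (\<lambda>y n. r n y)"
      by (simp add: continuous_map_componentwise_UNIV rc)
    ultimately have "continuous_map Y ?T (\<lambda>y n. r n y)"
      unfolding inverse_limit_def continuous_map_in_subtopology topspace_subtopology by blast
    from continuous_map_compose[OF this jc] have hc: "continuous_map Y V h"
      by (rule continuous_map_eq) (auto simp: h_def)
    have hV: "h y \<in> topspace V" if "y \<in> topspace Y" for y
      using hc that by (auto simp: continuous_map_def)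
    show "(Y, h, V) \<in> metrizable_compacta \<and> (\<forall>n. compose (topspace Y) (q n) h = r n)"
    proof (intro conjI allI)
      show "(Y, h, V) \<in> metrizable_compacta"
        by (intro metrizable_compactaI Y V hc) (simp add: h_def)
      show "compose (topspace Y) (q n) h = r n" for n
      proof (rule extensionalityI)
        show "r n \<in> extensional (topspace Y)" by (rule rE)
        show "compose (topspace Y) (q n) h y = r n y" if "y \<in> topspace Y" for y
          using that hV[OF that] j by (simp add: compose_eq q_def) (simp add: h_def)
      qed (rule compose_extensional)
    qed
    fix h' assume h': "(Y, h', V) \<in> metrizable_compacta \<and> (\<forall>n. compose (topspace Y) (q n) h' = r n)"
    show "h' = h"
    proof (rule extensionalityI)
      show "h' \<in> extensional (topspace Y)" using h' by (simp add: metrizable_compacta_def)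
      show "h \<in> extensional (topspace Y)" by (simp add: h_def)
      show "h' y = h y" if y: "y \<in> topspace Y" for y
      proof -
        have v: "h' y \<in> topspace V" using h' y by (auto simp: metrizable_compacta_def continuous_map_def)
        have "r n y = inv j (h' y) n" for n
          using h' y v by (metis (no_types, lifting) compose_eq q_def restrict_apply')
        then have "h y = j (inv j (h' y))" using y by (simp add: h_def)
        also have "\<dots> = h' y"
          using v by (auto simp: V_def topspace_pullback_topology f_inv_into_f)
        finally show ?thesis by simp
      qed
    qed
  qed
  then show ?thesis using cone homeo by (auto simp: limit_cone_def)
qed

section \<open>Degrees of circle maps\<close>

text \<open>A lift of \<open>f\<close> along the covering of the circle by the line, with angles
  measured in full turns; the increment \<open>k\<close> over one turn is the degree.\<close>

definition lifts :: "(complex \<Rightarrow> complex) \<Rightarrow> int \<Rightarrow> (real \<Rightarrow> real) \<Rightarrow> bool" where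
  "lifts f k Q \<longleftrightarrow> continuous_on UNIV Q \<and> (\<forall>t. Q (t + 1) = Q t + of_int k) \<and>
     (\<forall>t. f (cis (2 * pi * t)) = cis (2 * pi * Q t))"

lemma continuous_map_circle_iff:
  "continuous_map circle circle f \<longleftrightarrow>
     continuous_on (sphere 0 1) f \<and> (\<forall>z. norm z = 1 \<longrightarrow> norm (f z) = 1)"
  by (auto simp: circle_def continuous_map_in_subtopology image_subset_iff Pi_iff)

lemma topspace_circle [simp]: "topspace circle = sphere 0 1"
  by (simp add: circle_def)

lemma cis_2pi_surj:
  assumes "norm z = 1"
  shows "\<exists>t. z = cis (2 * pi * t)"
proof
  show "z = cis (2 * pi * (Arg z / (2 * pi)))"
    using assms rcis_cmod_Arg[of z] by (simp add: rcis_def)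
qed

lemma cis_2pi_eq_1_iff: "cis (2 * pi * t) = 1 \<longleftrightarrow> t \<in> \<int>"
proof
  assume "cis (2 * pi * t) = 1"
  then have "cos (2 * pi * t) = 1" by (simp add: complex_eq_iff)
  then obtain n :: int where "2 * pi * t = of_int n * 2 * pi"
    by (auto simp: cos_one_2pi_int)
  then have "t = of_int n" by simp
  then show "t \<in> \<int>" by simp
next
  assume "t \<in> \<int>"
  then obtain n where "t = of_int n" by (auto elim: Ints_cases)
  then show "cis (2 * pi * t) = 1"
    using cis_multiple_2pi[of t] by (simp add: mult.commute)
qed

lemma circlepath_cis: "circlepath 0 1 t = cis (2 * pi * t)"
  by (simp add: circlepath cis_conv_exp mult_ac)

text \<open>Pulled back to the contractible real line, \<open>f\<close> has a continuous logarithm,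
  whose imaginary part gives the lift.\<close>

lemma lift_exists:
  assumes "continuous_map circle circle f"
  obtains k Q where "lifts f k Q"
proof -
  have f: "continuous_on (sphere 0 1) f" "\<And>z. norm z = 1 \<Longrightarrow> norm (f z) = 1"
    using assms by (auto simp: continuous_map_circle_iff)
  let ?F = "\<lambda>t::real. f (cis (2 * pi * t))"
  have "continuous_on UNIV ?F"
    by (rule continuous_on_compose2[OF f(1)]) (auto intro!: continuous_intros)
  moreover have nz: "?F t \<noteq> 0" for t
    using f(2)[of "cis (2 * pi * t)"] by auto
  ultimately obtain g where g: "continuous_on UNIV g" "\<And>t. ?F t = exp (g t)"
    using continuous_logarithm_on_contractible[of UNIV ?F] by auto
  define Q where "Q t = Im (g t) / (2 * pi)" for t
  have Q: "continuous_on UNIV Q"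
    unfolding Q_def by (intro continuous_intros g) auto
  have FQ: "?F t = cis (2 * pi * Q t)" for t
  proof -
    have "norm (exp (g t)) = 1" using f(2)[of "cis (2 * pi * t)"] g(2) by simp
    then have "Re (g t) = 0" by simp
    then show ?thesis using g(2)[of t] by (simp add: exp_eq_polar Q_def)
  qed
  \<comment> \<open>\<open>D\<close> is continuous and integer-valued, hence constant; its value is
    \<open>k\<close>.\<close>
  define D where "D t = Q (t + 1) - Q t" for t
  have D: "D t \<in> \<int>" for t
  proof -
    have "cis (2 * pi * (t + 1)) = cis (2 * pi * t)"
      by (simp add: complex_eq_iff algebra_simps sin_add cos_add)
    then have "cis (2 * pi * Q (t + 1)) = cis (2 * pi * Q t)" by (metis FQ)
    moreover have "2 * pi * D t = 2 * pi * Q (t + 1) - 2 * pi * Q t"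
      by (simp add: D_def algebra_simps)
    ultimately have "cis (2 * pi * D t) = 1" by (simp flip: cis_divide)
    then show ?thesis by (simp add: cis_2pi_eq_1_iff)
  qed
  have "D constant_on UNIV"
  proof (rule continuous_discrete_range_constant)
    show "continuous_on UNIV D"
      unfolding D_def by (intro continuous_intros continuous_on_compose2[OF Q]) auto
    show "\<exists>e>0. \<forall>y. y \<in> UNIV \<and> D y \<noteq> D x \<longrightarrow> e \<le> norm (D y - D x)" for x
    proof (intro exI[of _ 1] conjI allI impI)
      fix y assume "y \<in> UNIV \<and> D y \<noteq> D x"
      then show "1 \<le> norm (D y - D x)"
        using D[of x] D[of y] by (simp add: Ints_nonzero_abs_ge1)
    qed simp
  qed simp
  then obtain c where c: "\<And>t. D t = c" by (auto simp: constant_on_def)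
  with D[of 0] obtain k :: int where "c = of_int k" by (auto elim: Ints_cases)
  then have "Q (t + 1) = Q t + of_int k" for t
    using c[of t] by (simp add: D_def)
  then show ?thesis using that Q FQ by (auto simp: lifts_def)
qed

text \<open>The winding number of \<open>exp \<circ> p\<close> about 0 is the increment of
  \<open>p\<close> divided by 2 pi i. A logarithm over a single turn is enough, which suits angles
  given piecewise.\<close>

lemma circle_degree_eq:
  assumes p: "path p" and f: "\<And>t. 0 \<le> t \<Longrightarrow> t \<le> 1 \<Longrightarrow> f (cis (2 * pi * t)) = exp (p t)"
    and k: "pathfinish p - pathstart p = 2 * of_real pi * \<i> * of_int k"
  shows "circle_degree f = k"
proof -
  have "winding_number (f \<circ> circlepath 0 1) 0 = winding_number (exp \<circ> p) 0"
    by (rule winding_number_cong) (use f in \<open>simp add: circlepath_cis\<close>)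
  also have "\<dots> = of_int k"
    using winding_number_compose_exp[OF p] k by simp
  finally show ?thesis
    unfolding circle_degree_def by simp
qed

lemma circle_degree_lifts:
  assumes "lifts f k Q"
  shows "circle_degree f = k"
proof (rule circle_degree_eq)
  have Q: "continuous_on UNIV Q" "Q (t + 1) = Q t + of_int k" "f (cis (2 * pi * t)) = cis (2 * pi * Q t)" for t
    using assms by (auto simp: lifts_def)
  let ?p = "\<lambda>t. \<i> * of_real (2 * pi * Q t)"
  show "path ?p"
    unfolding path_def by (intro continuous_intros continuous_on_subset[OF Q(1)]) auto
  show "f (cis (2 * pi * t)) = exp (?p t)" for t
    by (simp only: Q(3)) (simp add: cis_conv_exp)
  show "pathfinish ?p - pathstart ?p = 2 * of_real pi * \<i> * of_int k"
    using Q(2)[of 0] by (simp add: pathfinish_def pathstart_def algebra_simps)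
qed

lemma lifts_circle_degree:
  assumes "continuous_map circle circle f"
  obtains Q where "lifts f (circle_degree f) Q"
  using assms circle_degree_lifts lift_exists by metis

lemma lifts_add_int:
  assumes "lifts f k Q"
  shows "Q (t + of_int n) = Q t + of_int n * of_int k"
proof -
  have Q: "Q (s + 1) = Q s + of_int k" for s using assms by (simp add: lifts_def)
  have nat: "Q (s + of_nat m) = Q s + of_nat m * of_int k" for s m
  proof (induction m)
    case (Suc m)
    then show ?case using Q[of "s + of_nat m"] by (simp add: algebra_simps)
  qed simp
  show ?thesis
  proof (cases "n \<ge> 0")
    case True
    then show ?thesis using nat[of t "nat n"] by simp
  next
    case False
    then show ?thesis using nat[of "t + of_int n" "nat (- n)"] by (simp add: algebra_simps)
  qed
qed

lemma lifts_compose: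
  assumes g: "lifts g l R" and f: "lifts f k Q"
  shows "lifts (g \<circ> f) (l * k) (R \<circ> Q)"
proof -
  have "continuous_on UNIV (R \<circ> Q)"
    by (rule continuous_on_compose) (use assms in \<open>auto simp: lifts_def intro: continuous_on_subset\<close>)
  then show ?thesis
    using assms lifts_add_int[OF g] by (simp add: lifts_def mult.commute)
qed

lemma circle_degree_cong:
  assumes "\<And>z. norm z = 1 \<Longrightarrow> f z = g z"
  shows "circle_degree f = circle_degree g"
proof -
  have "winding_number (f \<circ> circlepath 0 1) 0 = winding_number (g \<circ> circlepath 0 1) 0"
    by (rule winding_number_cong) (simp add: assms circlepath_cis)
  then show ?thesis by (simp add: circle_degree_def)
qed

lemma circle_degree_compose:
  assumes "continuous_map circle circle g" "continuous_map circle circle f"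
  shows "circle_degree (g \<circ> f) = circle_degree g * circle_degree f"
  by (metis assms circle_degree_lifts lifts_circle_degree lifts_compose)

text \<open>The lift is unbounded above and below, so by connectedness it is onto the line.
  Surjectivity in \<open>circle_cat\<close> thus comes with the degree condition.\<close>

lemma circle_surjection_if_degree_nonzero:
  assumes f: "continuous_map circle circle f" and "circle_degree f \<noteq> 0"
  shows "circle_surjection f"
proof -
  obtain Q where Q: "lifts f (circle_degree f) Q" using f by (rule lifts_circle_degree)
  let ?k = "circle_degree f"
  have "z \<in> f ` sphere 0 1" if z: "norm z = 1" for z
  proof -
    obtain s where s: "z = cis (2 * pi * s)" using cis_2pi_surj[OF z] by blast
    \<comment> \<open>Over \<open>n\<close> turns the lift moves by at least \<open>n\<close>, the
      degree being a nonzero integer, so its values at \<open>n\<close> and \<open>- n\<close>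
      enclose \<open>s\<close>.\<close>
    define n where "n = \<lceil>\<bar>s - Q 0\<bar>\<rceil>"
    have n: "\<bar>s - Q 0\<bar> \<le> of_int n" unfolding n_def by (rule le_of_int_ceiling)
    have "of_int n \<le> of_int n * \<bar>real_of_int ?k\<bar>"
    proof -
      have "\<bar>?k\<bar> \<ge> 1" using assms(2) by linarith
      then have "\<bar>real_of_int ?k\<bar> \<ge> 1" by linarith
      moreover have "(0::real) \<le> of_int n" using n by linarith
      ultimately show ?thesis using mult_left_mono[of 1 "\<bar>real_of_int ?k\<bar>" "of_int n"] by simp
    qed
    then have bd: "\<bar>s - Q 0\<bar> \<le> of_int n * \<bar>real_of_int ?k\<bar>" using n by linarith
    have ends: "Q (of_int n) = Q 0 + of_int n * of_int ?k" "Q (of_int (- n)) = Q 0 - of_int n * of_int ?k"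
      using lifts_add_int[OF Q, of 0 n] lifts_add_int[OF Q, of 0 "- n"] by simp_all
    have conn: "connected (range Q)"
      using Q by (intro connected_continuous_image) (auto simp: lifts_def)
    have "s \<in> range Q"
    proof (cases "?k > 0")
      case True
      then have "Q (of_int (- n)) \<le> s" "s \<le> Q (of_int n)" using bd ends by auto
      then show ?thesis by (rule connectedD_interval[OF conn rangeI rangeI])
    next
      case False
      then have "\<bar>real_of_int ?k\<bar> = - of_int ?k" by simp
      then have "Q (of_int n) \<le> s" "s \<le> Q (of_int (- n))" using bd ends by auto
      then show ?thesis by (rule connectedD_interval[OF conn rangeI rangeI])
    qed
    then obtain t where "s = Q t" by blast
    then have "z = f (cis (2 * pi * t))" using Q s by (simp add: lifts_def)
    then show ?thesis by simp
  qed
  then show ?thesis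
    using f by (auto simp: circle_surjection_def continuous_map_circle_iff)
qed

text \<open>If the degrees differ, the difference of two lifts changes by a nonzero integer over one
  turn, so somewhere it is an integer plus 1/2; there the two values are antipodal, at distance
  2.\<close>

lemma circle_degree_close:
  assumes f: "continuous_map circle circle f" and g: "continuous_map circle circle g"
    and close: "\<And>z. norm z = 1 \<Longrightarrow> dist (f z) (g z) < 2"
  shows "circle_degree f = circle_degree g"
proof (rule ccontr)
  assume ne: "circle_degree f \<noteq> circle_degree g"
  obtain Q R where Q: "lifts f (circle_degree f) Q" and R: "lifts g (circle_degree g) R"
    using f g lifts_circle_degree by metis
  define D where "D t = Q t - R t" for t
  define m where "m = circle_degree f - circle_degree g"
  have D1: "D 1 = D 0 + of_int m"
    using lifts_add_int[OF Q, of 0 1] lifts_add_int[OF R, of 0 1] by (simp add: D_def m_def)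
  have m: "m \<ge> 1 \<or> m \<le> -1" using ne by (auto simp: m_def)
  have conn: "connected (range D)"
    using Q R unfolding D_def
    by (intro connected_continuous_image continuous_intros) (auto simp: lifts_def)
  \<comment> \<open>The least integer plus 1/2 not below the smaller end value. It is less than 1
    above that value, while the end values are at least 1 apart.\<close>
  define x :: real where "x = of_int \<lceil>min (D 0) (D 1) - 1/2\<rceil> + 1/2"
  have "min (D 0) (D 1) \<le> x" "x \<le> min (D 0) (D 1) + 1" unfolding x_def by linarith+
  moreover have "real_of_int m \<ge> 1 \<or> real_of_int m \<le> -1" using m by linarith
  ultimately have "D 0 \<le> x \<and> x \<le> D 1 \<or> D 1 \<le> x \<and> x \<le> D 0"
    using D1 by (auto simp: min_def split: if_splits)
  then have "x \<in> range D"
    using connectedD_interval[OF conn, of "D 0" "D 1" x] connectedD_interval[OF conn, of "D 1" "D 0" x]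
    by auto
  then obtain t where t: "D t = x" by blast
  let ?z = "cis (2 * pi * t)"
  obtain n :: int where n: "x = of_int n + 1/2" unfolding x_def by blast
  have "2 * pi * Q t = 2 * pi * R t + (2 * pi * of_int n + pi)"
    using t n by (simp add: D_def field_simps)
  then have "cis (2 * pi * Q t) = cis (2 * pi * R t) * (cis (2 * pi * of_int n) * cis pi)"
    by (simp only: cis_mult)
  then have "f ?z = g ?z * (cis (2 * pi * of_int n) * cis pi)"
    using Q R by (simp only: lifts_def)
  then have "f ?z = - g ?z"
    using cis_2pi_eq_1_iff[of "of_int n"] by simp
  moreover have "norm (g ?z) = 1" using R by (simp add: lifts_def)
  ultimately have "dist (f ?z) (g ?z) = 2"
    by (simp add: dist_norm norm_minus_commute flip: mult_2)
  then show False using close[of ?z] by simp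
qed

lemma circle_degree_power: "circle_degree (\<lambda>z. z ^ p) = int p"
proof (rule circle_degree_lifts)
  have "cis (2 * pi * t) ^ p = cis (2 * pi * (of_nat p * t))" for t
    by (subst Complex.DeMoivre) (simp add: mult_ac)
  then show "lifts (\<lambda>z. z ^ p) (int p) (\<lambda>t. of_nat p * t)"
    by (auto simp: lifts_def distrib_left intro!: continuous_intros)
qed

section \<open>Folding the circle between two points\<close>

text \<open>The piecewise linear function through \<open>(1, 0)\<close>, \<open>(1/2, 1 - e)\<close>, \<open>(-1/2, e)\<close> and \<open>(-1, 1)\<close>.\<close>

definition zigzag :: "real \<Rightarrow> real \<Rightarrow> real" where
  "zigzag e x = max (min (2 * (1 - e) * (1 - x)) (1/2 + (1 - 2 * e) * x)) (1 - 2 * (1 - e) * (1 + x))"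

lemma zigzag_values:
  assumes "0 < e" "e < 1/2"
  shows "zigzag e 1 = 0" "zigzag e (-1) = 1" "zigzag e (1/2) = 1 - e" "zigzag e (-1/2) = e"
  using assms by (auto simp: zigzag_def field_simps max_def min_def)

text \<open>\<open>zigzag\<close> will be the position along an arc from \<open>a\<close>, at 0, to
  \<open>b\<close>, at 1; this bound keeps points with real part at most 1/2 away from
  \<open>a\<close>.\<close>

lemma zigzag_lower:
  assumes "0 < e" "e < 1/2" "x \<le> 1/2"
  shows "e \<le> zigzag e x"
proof (cases "x \<le> -1/2")
  case True
  then have "0 \<le> (1 - e) * (- 1 - 2 * x)" using assms by (intro mult_nonneg_nonneg) auto
  then show ?thesis by (auto simp: zigzag_def algebra_simps le_max_iff_disj)
next
  case False
  then have "0 \<le> (1 - 2 * e) * (x + 1/2)" using assms by (intro mult_nonneg_nonneg) auto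
  moreover have "0 \<le> (1 - e) * (1 - 2 * x)" using assms by (intro mult_nonneg_nonneg) auto
  ultimately show ?thesis using assms by (auto simp: zigzag_def algebra_simps le_max_iff_disj)
qed

text \<open>The mirror bound, keeping points with real part at least -1/2 away from
  \<open>b\<close>.\<close>

lemma zigzag_upper:
  assumes "0 < e" "e < 1/2" "- 1/2 \<le> x"
  shows "zigzag e x \<le> 1 - e"
proof -
  have "0 \<le> (1 - e) * (1 + 2 * x)" using assms by (intro mult_nonneg_nonneg) auto
  moreover have "0 \<le> (1 - 2 * e) * (1/2 - x) \<or> 0 \<le> (1 - e) * (2 * x - 1)"
    using assms by (cases "x \<le> 1/2") (auto intro!: mult_nonneg_nonneg)
  ultimately show ?thesis using assms by (auto simp: zigzag_def algebra_simps min_le_iff_disj)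
qed

lemma zigzag_bounds:
  assumes e: "0 < e" "e < 1/2" and x: "\<bar>x\<bar> \<le> 1"
  shows "0 \<le> zigzag e x" "zigzag e x \<le> 1"
proof -
  show "0 \<le> zigzag e x"
  proof (cases "x \<le> 1/2")
    case False
    then have "0 \<le> (1 - e) * (1 - x)" "0 \<le> (1 - 2 * e) * x"
      using e x by (auto intro!: mult_nonneg_nonneg)
    then show ?thesis by (auto simp: zigzag_def algebra_simps le_max_iff_disj)
  qed (use zigzag_lower e in fastforce)
  show "zigzag e x \<le> 1"
  proof (cases "- 1/2 \<le> x")
    case False
    then have "0 \<le> (1 - e) * (1 + x)" "0 \<le> (1 - 2 * e) * (- x)"
      using e x by (intro mult_nonneg_nonneg; simp)+
    then show ?thesis by (auto simp: zigzag_def algebra_simps min_le_iff_disj)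
  qed (use zigzag_upper e in fastforce)
qed

lemma cis_eq_1_small:
  assumes "cis x = 1" "\<bar>x\<bar> < 2 * pi"
  shows "x = 0"
proof -
  have "cis (2 * pi * (x / (2 * pi))) = 1" using assms by simp
  then obtain k :: int where k: "x / (2 * pi) = of_int k"
    unfolding cis_2pi_eq_1_iff by (auto elim: Ints_cases)
  have "\<bar>x / (2 * pi)\<bar> < 1" using assms(2) by simp
  then have "k = 0" unfolding k by linarith
  then show ?thesis using k by simp
qed

lemma norm_cis_minus_1: "norm (cis x - 1) \<le> \<bar>x\<bar>"
proof -
  have "norm (cis x - 1) = 2 * \<bar>sin (x / 2)\<bar>"
    using dist_exp_i_1[of x] by (simp add: cis_conv_exp)
  also have "\<dots> \<le> \<bar>x\<bar>" using abs_sin_x_le_abs_x[of "x / 2"] by simp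
  finally show ?thesis .
qed

lemma norm_1_Re_bound: "norm z = 1 \<Longrightarrow> \<bar>Re z\<bar> \<le> 1"
  using abs_Re_le_cmod[of z] by simp

text \<open>The witness runs along each arc from \<open>a\<close> to just short of \<open>b\<close>, back to just short of \<open>a\<close>, and
  then to \<open>b\<close>, turning at the points with real part \<open>1/2\<close> and \<open>-1/2\<close>.\<close>

lemma fold_map_exists:
  assumes a: "norm a = 1" and b: "norm b = 1" and "a \<noteq> b" and "\<eta> > 0"
  shows "\<exists>g \<delta>. continuous_map circle circle g \<and> circle_degree g = 1 \<and> \<delta> > 0 \<and>
    (\<forall>z. norm z = 1 \<longrightarrow>
       (Re z = 1/2 \<longrightarrow> dist (g z) b < \<eta>) \<and> (Re z = - 1/2 \<longrightarrow> dist (g z) a < \<eta>) \<and>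
       (Re z \<le> 1/2 \<longrightarrow> \<delta> \<le> dist (g z) a) \<and> (- 1/2 \<le> Re z \<longrightarrow> \<delta> \<le> dist (g z) b))"
proof -
  obtain s where s: "a = cis (2 * pi * s)" using cis_2pi_surj[OF a] by blast
  have "norm (b / a) = 1" using a b by (simp add: norm_divide)
  then obtain r where r: "b / a = cis (2 * pi * r)" using cis_2pi_surj by blast
  \<comment> \<open>The angle from \<open>a\<close> to \<open>b\<close>, normalized to lie strictly
    between 0 and 2 pi; the other arc has the signed angle \<open>\<gamma> - 2 * pi\<close>.\<close>
  define \<gamma> where "\<gamma> = 2 * pi * frac r"
  have "cis \<gamma> = cis (2 * pi * r) / cis (2 * pi * of_int \<lfloor>r\<rfloor>)"
    unfolding cis_divide by (simp only: \<gamma>_def frac_def right_diff_distrib)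
  also have "cis (2 * pi * of_int \<lfloor>r\<rfloor>) = 1" by (simp only: cis_2pi_eq_1_iff Ints_of_int)
  finally have "b / a = cis \<gamma>" using r by simp
  moreover have "a \<noteq> 0" using a by auto
  ultimately have b_eq: "b = a * cis \<gamma>" by (simp add: field_simps)
  have \<gamma>: "0 < \<gamma>" "\<gamma> < 2 * pi"
  proof -
    have "frac r \<noteq> 0" using b_eq \<open>a \<noteq> b\<close> by (auto simp: \<gamma>_def)
    then have "0 < frac r" using frac_ge_0[of r] by linarith
    then show "0 < \<gamma>" "\<gamma> < 2 * pi"
      using frac_lt_1[of r] by (auto simp: \<gamma>_def)
  qed
  have cis_\<gamma>: "cis (\<gamma> - 2 * pi) = cis \<gamma>"
    by (simp flip: cis_divide)
  \<comment> \<open>Both signed angles are below 2 pi in absolute value, so turning back a fraction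
    \<open>e\<close> short of an end leaves a gap smaller than \<open>\<eta>\<close>.\<close>
  define e where "e = min (1/4) (\<eta> / (4 * pi))"
  have e: "0 < e" "e < 1/2" "2 * pi * e < \<eta>"
  proof -
    show "0 < e" "e < 1/2" using \<open>\<eta> > 0\<close> by (auto simp: e_def)
    have "2 * pi * e \<le> 2 * pi * (\<eta> / (4 * pi))" by (intro mult_left_mono) (auto simp: e_def)
    then show "2 * pi * e < \<eta>" using \<open>\<eta> > 0\<close> by simp
  qed
  let ?\<zeta> = "\<lambda>z. zigzag e (Re z)"
  \<comment> \<open>The upper semicircle is folded over one arc from \<open>a\<close> to
    \<open>b\<close>, the lower over the other. The two halves fit at 1 and -1, where
    \<open>zigzag\<close> is 0 and 1.\<close>
  define g where "g z = (if Im z \<le> 0 then a * cis ((\<gamma> - 2 * pi) * ?\<zeta> z) else a * cis (\<gamma> * ?\<zeta> z))" for z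
  have ends: "cis ((\<gamma> - 2 * pi) * ?\<zeta> z) = cis (\<gamma> * ?\<zeta> z)" if "norm z = 1" "Im z = 0" for z
  proof -
    have "\<bar>Re z\<bar> = 1" using that by (simp add: cmod_def)
    then have "?\<zeta> z = 0 \<or> ?\<zeta> z = 1"
      using zigzag_values[OF e(1,2)] by (metis abs_eq_iff abs_one)
    then show ?thesis using cis_\<gamma> by auto
  qed
  have g_upper: "g z = a * cis (\<gamma> * ?\<zeta> z)" if "norm z = 1" "0 \<le> Im z" for z
    using that ends[OF that(1)] by (auto simp: g_def)
  \<comment> \<open>A common form for both arcs, with signed angle \<open>\<sigma>\<close>, lets
    each later estimate be made once.\<close>
  have g_form: "\<exists>\<sigma>. 0 < \<bar>\<sigma>\<bar> \<and> \<bar>\<sigma>\<bar> < 2 * pi \<and> b = a * cis \<sigma> \<and> g z = a * cis (\<sigma> * ?\<zeta> z)" for z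
  proof (cases "Im z \<le> 0")
    case True
    then show ?thesis
      using \<gamma> b_eq cis_\<gamma> by (intro exI[of _ "\<gamma> - 2 * pi"]) (simp add: g_def)
  next
    case False
    then show ?thesis
      using \<gamma> b_eq by (intro exI[of _ \<gamma>]) (simp add: g_def)
  qed
  have cont: "continuous_on (sphere 0 1) g"
    unfolding g_def
  proof (rule continuous_on_cases_le)
    show "a * cis ((\<gamma> - 2 * pi) * ?\<zeta> z) = a * cis (\<gamma> * ?\<zeta> z)" if "z \<in> sphere 0 1" "Im z = 0" for z
      using ends that by simp
  qed (auto simp: zigzag_def intro!: continuous_intros)
  have cm: "continuous_map circle circle g"
    unfolding continuous_map_circle_iff using cont a by (auto simp: g_def norm_mult)
  have deg: "circle_degree g = 1"
  proof (rule circle_degree_eq)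
    \<comment> \<open>The angle of \<open>g\<close> measured from \<open>a\<close>. Adding 2 pi in
      the second branch makes the branches agree at 1/2 and the final value 2 pi, one full
      turn.\<close>
    let ?q = "\<lambda>t. if t \<le> 1/2 then \<gamma> * zigzag e (cos (2 * pi * t))
                  else 2 * pi + (\<gamma> - 2 * pi) * zigzag e (cos (2 * pi * t))"
    let ?p = "\<lambda>t. \<i> * of_real (2 * pi * s + ?q t)"
    have half: "cos (2 * pi * (1/2)) = - 1" by simp
    have "continuous_on {0..1} ?q"
    proof (rule continuous_on_cases_le)
      show "\<gamma> * zigzag e (cos (2 * pi * t)) = 2 * pi + (\<gamma> - 2 * pi) * zigzag e (cos (2 * pi * t))"
        if "t = 1/2" for t
        unfolding that half zigzag_values(2)[OF e(1,2)] by simp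
    qed (auto simp: zigzag_def intro!: continuous_intros)
    then show "path ?p"
      unfolding path_def by (intro continuous_intros)
    show "g (cis (2 * pi * t)) = exp (?p t)" if "0 \<le> t" "t \<le> 1" for t
    proof -
      have "exp (?p t) = cis (2 * pi * s + ?q t)" by (simp only: cis_conv_exp)
      also have "\<dots> = a * cis (?q t)" by (simp only: s cis_mult)
      also have "\<dots> = g (cis (2 * pi * t))"
      proof (cases "t \<le> 1/2")
        case True
        then have "0 \<le> sin (2 * pi * t)" using that by (intro sin_ge_zero) auto
        then show ?thesis using True by (simp add: g_upper)
      next
        case False
        have "sin (2 * pi * t) = - sin (2 * pi * t - pi)" by (simp add: sin_diff)
        moreover have "2 * pi * t - pi = pi * (2 * t - 1)" by (simp add: algebra_simps)
        moreover have "0 \<le> pi * (2 * t - 1)" "pi * (2 * t - 1) \<le> pi * 1"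
          using False that by (auto intro!: mult_left_mono)
        ultimately have "sin (2 * pi * t) \<le> 0"
          using sin_ge_zero[of "pi * (2 * t - 1)"] by simp
        then show ?thesis using False by (simp add: g_def flip: cis_mult)
      qed
      finally show ?thesis by simp
    qed
    show "pathfinish ?p - pathstart ?p = 2 * of_real pi * \<i> * of_int 1"
      using zigzag_values(1)[OF e(1,2)] by (simp add: pathfinish_def pathstart_def algebra_simps)
  qed
  have near_b: "dist (g z) b < \<eta>" if "Re z = 1/2" for z
  proof -
    obtain \<sigma> where \<sigma>: "\<bar>\<sigma>\<bar> < 2 * pi" "b = a * cis \<sigma>" "g z = a * cis (\<sigma> * ?\<zeta> z)" using g_form by blast
    have "g z - b = b * (cis (- (\<sigma> * e)) - 1)"
      using \<sigma>(2,3) zigzag_values(3)[OF e(1,2)] that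
      by (simp add: right_diff_distrib cis_mult mult.assoc)
    then have "dist (g z) b = norm (cis (- (\<sigma> * e)) - 1)"
      using b by (simp add: dist_norm norm_mult)
    also have "\<dots> \<le> \<bar>\<sigma>\<bar> * e" using norm_cis_minus_1[of "- (\<sigma> * e)"] e by (simp add: abs_mult)
    also have "\<dots> \<le> 2 * pi * e" using \<sigma>(1) e by (intro mult_right_mono) auto
    finally show ?thesis using e by simp
  qed
  have near_a: "dist (g z) a < \<eta>" if "Re z = - 1/2" for z
  proof -
    obtain \<sigma> where \<sigma>: "\<bar>\<sigma>\<bar> < 2 * pi" "g z = a * cis (\<sigma> * ?\<zeta> z)" using g_form by blast
    have "g z - a = a * (cis (\<sigma> * e) - 1)"
      using \<sigma>(2) zigzag_values(4)[OF e(1,2)] that by (simp add: right_diff_distrib)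
    then have "dist (g z) a = norm (cis (\<sigma> * e) - 1)"
      using a by (simp add: dist_norm norm_mult)
    also have "\<dots> \<le> \<bar>\<sigma>\<bar> * e" using norm_cis_minus_1[of "\<sigma> * e"] e by (simp add: abs_mult)
    also have "\<dots> \<le> 2 * pi * e" using \<sigma>(1) e by (intro mult_right_mono) auto
    finally show ?thesis using e by simp
  qed
  \<comment> \<open>Reaching \<open>a\<close> would make \<open>\<sigma> * ?\<zeta> z\<close> a
    multiple of 2 pi, but it is nonzero, as \<open>?\<zeta> z\<close> is at least \<open>e\<close>,
    and below 2 pi in absolute value.\<close>
  have ne_a: "g z \<noteq> a" if z: "norm z = 1" "Re z \<le> 1/2" for z
  proof
    assume "g z = a"
    obtain \<sigma> where \<sigma>: "0 < \<bar>\<sigma>\<bar>" "\<bar>\<sigma>\<bar> < 2 * pi" "g z = a * cis (\<sigma> * ?\<zeta> z)" using g_form by blast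
    have u: "e \<le> ?\<zeta> z" "?\<zeta> z \<le> 1"
      using zigzag_lower[OF e(1,2) z(2)] zigzag_bounds[OF e(1,2) norm_1_Re_bound[OF z(1)]] by auto
    have "cis (\<sigma> * ?\<zeta> z) = 1" using \<sigma>(3) \<open>g z = a\<close> \<open>a \<noteq> 0\<close> by simp
    moreover have "\<bar>\<sigma> * ?\<zeta> z\<bar> < 2 * pi"
    proof -
      have "\<bar>\<sigma> * ?\<zeta> z\<bar> \<le> \<bar>\<sigma>\<bar> * 1" unfolding abs_mult using u e by (intro mult_left_mono) auto
      then show ?thesis using \<sigma>(2) by simp
    qed
    ultimately have "\<sigma> * ?\<zeta> z = 0" by (rule cis_eq_1_small)
    then show False using \<sigma>(1) u e by simp
  qed
  have ne_b: "g z \<noteq> b" if z: "norm z = 1" "- 1/2 \<le> Re z" for z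
  proof
    assume "g z = b"
    obtain \<sigma> where \<sigma>: "0 < \<bar>\<sigma>\<bar>" "\<bar>\<sigma>\<bar> < 2 * pi" "b = a * cis \<sigma>" "g z = a * cis (\<sigma> * ?\<zeta> z)"
      using g_form by blast
    have u: "0 \<le> ?\<zeta> z" "?\<zeta> z \<le> 1 - e"
      using zigzag_upper[OF e(1,2) z(2)] zigzag_bounds[OF e(1,2) norm_1_Re_bound[OF z(1)]] by auto
    have "cis (\<sigma> * (1 - ?\<zeta> z)) = cis \<sigma> / cis (\<sigma> * ?\<zeta> z)"
      by (simp add: cis_divide right_diff_distrib)
    also have "\<dots> = 1" using \<sigma>(3,4) \<open>g z = b\<close> \<open>a \<noteq> 0\<close> by simp
    finally have "cis (\<sigma> * (1 - ?\<zeta> z)) = 1" .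
    moreover have "\<bar>\<sigma> * (1 - ?\<zeta> z)\<bar> < 2 * pi"
    proof -
      have "\<bar>\<sigma> * (1 - ?\<zeta> z)\<bar> \<le> \<bar>\<sigma>\<bar> * 1" unfolding abs_mult using u e by (intro mult_left_mono) auto
      then show ?thesis using \<sigma>(2) by simp
    qed
    ultimately have "\<sigma> * (1 - ?\<zeta> z) = 0" by (rule cis_eq_1_small)
    then show False using \<sigma>(1) u e by simp
  qed
  \<comment> \<open>Compactness turns pointwise avoidance into a uniform distance.\<close>
  have separated: "\<exists>d>0. \<forall>z\<in>sphere 0 1 \<inter> S. d \<le> dist (g z) c"
    if "closed S" "\<And>z. norm z = 1 \<Longrightarrow> z \<in> S \<Longrightarrow> g z \<noteq> c" for S c
  proof -
    have "compact (sphere 0 1 \<inter> S)" using that(1) by (intro compact_Int_closed) auto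
    then have "compact (g ` (sphere 0 1 \<inter> S))"
      by (intro compact_continuous_image continuous_on_subset[OF cont]) auto
    then have "closed (g ` (sphere 0 1 \<inter> S))" by (rule compact_imp_closed)
    moreover have "c \<notin> g ` (sphere 0 1 \<inter> S)" using that(2) by (metis IntE image_iff mem_sphere_0)
    ultimately show ?thesis
      using separate_point_closed by (metis dist_commute imageI)
  qed
  have "\<exists>d>0. \<forall>z\<in>sphere 0 1 \<inter> {z. Re z \<le> 1/2}. d \<le> dist (g z) a"
    by (rule separated[OF closed_halfspace_Re_le]) (simp add: ne_a)
  then obtain d1 where d1: "d1 > 0" "\<And>z. norm z = 1 \<Longrightarrow> Re z \<le> 1/2 \<Longrightarrow> d1 \<le> dist (g z) a"
    by fastforce
  have "\<exists>d>0. \<forall>z\<in>sphere 0 1 \<inter> {z. - 1/2 \<le> Re z}. d \<le> dist (g z) b"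
    by (rule separated[OF closed_halfspace_Re_ge]) (simp add: ne_b)
  then obtain d2 where d2: "d2 > 0" "\<And>z. norm z = 1 \<Longrightarrow> - 1/2 \<le> Re z \<Longrightarrow> d2 \<le> dist (g z) b"
    by fastforce
  show ?thesis
    using cm deg d1 d2 near_a near_b
    by (intro exI[of _ g] exI[of _ "min d1 d2"]) (auto simp: min_le_iff_disj)
qed

section \<open>Hereditary indecomposability of the limit\<close>

lemma bond_thread:
  assumes "n \<le> m" and x: "\<And>i. x i \<in> topspace (X i)" "\<And>i. x i = f i (x (Suc i))"
  shows "bond X f n m (x m) = x n"
  using assms(1)
proof (induction m)
  case (Suc m)
  show ?case
  proof (cases "n \<le> m")
    case True
    then have "bond X f n (Suc m) (x (Suc m)) = bond X f n m (f m (x (Suc m)))"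
      by (simp add: compose_eq x(1))
    also have "f m (x (Suc m)) = x m" by (rule x(2)[symmetric])
    finally show ?thesis using Suc.IH True by simp
  next
    case False
    then have "n = Suc m" using Suc.prems by simp
    then show ?thesis using x(1) by (simp add: id_map_apply)
  qed
qed (use x(1) in \<open>simp add: id_map_apply\<close>)

lemma hereditarily_indecomposable_homeomorphic:
  assumes "X homeomorphic_space Y" and Y: "hereditarily_indecomposable Y"
  shows "hereditarily_indecomposable X"
  unfolding hereditarily_indecomposable_def
proof (intro allI impI)
  obtain h where h: "homeomorphic_map X Y h"
    using assms(1) homeomorphic_space by blast
  fix C D assume C: "subcontinuum X C" and D: "subcontinuum X D"
  have sub: "C \<subseteq> topspace X" "D \<subseteq> topspace X"
    using C D by (auto simp: subcontinuum_def dest: compactin_subset_topspace)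
  have inj: "inj_on h (topspace X)" and cont: "continuous_map X Y h"
    using h by (auto simp: homeomorphic_eq_everything_map)
  have "subcontinuum Y (h ` C)" "subcontinuum Y (h ` D)"
    using C D cont by (auto simp: subcontinuum_def image_compactin connectedin_continuous_map_image)
  then have "h ` C \<inter> h ` D = {} \<or> h ` C \<subseteq> h ` D \<or> h ` D \<subseteq> h ` C"
    using Y by (simp add: hereditarily_indecomposable_def)
  then show "C \<inter> D = {} \<or> C \<subseteq> D \<or> D \<subseteq> C"
    using inj_on_image_subset_iff[OF inj] sub by blast
qed

text \<open>Agreement with \<open>c\<close> passes down the bonding maps. If it occurred in
  \<open>D\<close> at arbitrarily late coordinates, the closed sets \<open>E n\<close> would be
  nonempty and nested, and their common point would be \<open>c\<close> itself.\<close>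

lemma inverse_limit_separates:
  assumes T: "compact_space (inverse_limit X f)" and H: "\<And>n. Hausdorff_space (X n)"
    and D: "closedin (inverse_limit X f) D" and c: "c \<in> topspace (inverse_limit X f)" "c \<notin> D"
  shows "\<exists>n. \<forall>m\<ge>n. \<forall>x\<in>D. x m \<noteq> c m"
proof (rule ccontr)
  let ?T = "inverse_limit X f"
  assume not: "\<not> ?thesis"
  define E where "E n = D \<inter> {x \<in> topspace ?T. x n \<in> {c n}}" for n
  have thread: "x n = f n (x (Suc n))" "x n \<in> topspace (X n)" if "x \<in> topspace ?T" for x n
    using that unfolding topspace_inverse_limit by blast+
  have decr: "decseq E"
  proof (rule decseq_SucI, rule subsetI)
    fix n x assume "x \<in> E (Suc n)"
    then show "x \<in> E n"
      using thread(1)[of x n] thread(1)[OF c(1), of n] by (auto simp: E_def)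
  qed
  have closed: "closedin ?T (E n)" for n
    unfolding E_def
    by (intro closedin_Int D closedin_continuous_map_preimage[OF continuous_map_inverse_limit_projection]
        closedin_Hausdorff_singleton H thread(2) c(1))
  have "E n \<noteq> {}" for n
  proof -
    obtain m x where "m \<ge> n" "x \<in> D" "x m = c m" using not by blast
    then have "x \<in> E m" using D closedin_subset by (auto simp: E_def)
    moreover have "E m \<subseteq> E n" using decr \<open>m \<ge> n\<close> by (simp add: decseq_def)
    ultimately show ?thesis by blast
  qed
  then have "(\<Inter>n. E n) \<noteq> {}"
    using compact_space_imp_nest[OF T closed _ decr] by blast
  then obtain x where "\<And>n. x \<in> E n" by blast
  then have "x \<in> D" "x = c" by (auto simp: E_def)
  then show False using c by simp
qed

lemma hereditarily_indecomposable_inverse_limit: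
  assumes f: "\<And>n. continuous_map circle circle (f n)"
    and absorb: "\<And>n g \<delta>. continuous_map circle circle g \<Longrightarrow> circle_degree g = 1 \<Longrightarrow> \<delta> > 0 \<Longrightarrow>
      \<exists>m\<ge>n. \<exists>h. continuous_map circle circle h \<and>
        (\<forall>z. norm z = 1 \<longrightarrow> dist (g (h z)) (bond (\<lambda>_. circle) f n m z) < \<delta>)"
  shows "hereditarily_indecomposable (inverse_limit (\<lambda>_. circle) f)"
  unfolding hereditarily_indecomposable_def
proof (intro allI impI)
  let ?T = "inverse_limit (\<lambda>_. circle) f"
  have haus: "Hausdorff_space circle"
    by (simp add: circle_def Hausdorff_space_subtopology)
  have compT: "compact_space ?T"
    by (rule compact_space_inverse_limit) (simp_all add: f haus compact_space_circle)
  have hausT: "Hausdorff_space ?T"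
    unfolding inverse_limit_def
    by (simp add: Hausdorff_space_subtopology Hausdorff_space_product_topology haus)
  fix C D assume C: "subcontinuum ?T C" and D: "subcontinuum ?T D"
  have sub: "C \<subseteq> topspace ?T" "D \<subseteq> topspace ?T" and cl: "closedin ?T C" "closedin ?T D"
    using C D hausT by (auto simp: subcontinuum_def compactin_imp_closedin dest: compactin_subset_topspace)
  show "C \<inter> D = {} \<or> C \<subseteq> D \<or> D \<subseteq> C"
  proof (rule ccontr)
    assume not: "\<not> ?thesis"
    then obtain c d where c: "c \<in> C" "c \<notin> D" and d: "d \<in> D" "d \<notin> C" by blast
    obtain n1 where n1: "\<And>m x. m \<ge> n1 \<Longrightarrow> x \<in> D \<Longrightarrow> x m \<noteq> c m"
      using inverse_limit_separates[OF compT haus cl(2), of c] c sub by blast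
    obtain n2 where n2: "\<And>m x. m \<ge> n2 \<Longrightarrow> x \<in> C \<Longrightarrow> x m \<noteq> d m"
      using inverse_limit_separates[OF compT haus cl(1), of d] d sub by blast
    define n where "n = max n1 n2"
    have nD: "x n \<noteq> c n" if "x \<in> D" for x using n1 that by (simp add: n_def)
    have nC: "x n \<noteq> d n" if "x \<in> C" for x using n2 that by (simp add: n_def)
    have far: "\<exists>\<eta>>0. \<forall>x\<in>S. \<eta> \<le> dist (x n) w"
      if S: "subcontinuum ?T S" and "\<And>x. x \<in> S \<Longrightarrow> x n \<noteq> w" for S w
    proof -
      have "compactin circle ((\<lambda>x. x n) ` S)"
        using S continuous_map_inverse_limit_projection[of "\<lambda>_. circle" f n]
        by (auto simp: subcontinuum_def intro: image_compactin)
      then have "closed ((\<lambda>x. x n) ` S)"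
        by (auto simp: circle_def compactin_subtopology intro: compact_imp_closed)
      moreover have "w \<notin> (\<lambda>x. x n) ` S" using that(2) by auto
      ultimately show ?thesis using separate_point_closed by (metis dist_commute imageI)
    qed
    obtain \<eta>1 where \<eta>1: "\<eta>1 > 0" "\<And>x. x \<in> D \<Longrightarrow> \<eta>1 \<le> dist (x n) (c n)"
      using far[of D "c n"] D nD by blast
    obtain \<eta>2 where \<eta>2: "\<eta>2 > 0" "\<And>x. x \<in> C \<Longrightarrow> \<eta>2 \<le> dist (x n) (d n)"
      using far[of C "d n"] C nC by blast
    \<comment> \<open>Halved so that no point is within \<open>\<eta>\<close> of both
      \<open>x n\<close> and \<open>d n\<close> for \<open>x\<close> in \<open>C\<close>, nor of
      both \<open>x n\<close> and \<open>c n\<close> for \<open>x\<close> in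
      \<open>D\<close>.\<close>
    define \<eta> where "\<eta> = min \<eta>1 \<eta>2 / 2"
    have \<eta>: "\<eta> > 0" "2 * \<eta> \<le> \<eta>1" "2 * \<eta> \<le> \<eta>2" using \<eta>1 \<eta>2 by (auto simp: \<eta>_def)
    have thread: "x i \<in> topspace circle" "x i = f i (x (Suc i))" if "x \<in> topspace ?T" for x i
      using that unfolding topspace_inverse_limit by blast+
    have on_circle: "norm (x i) = 1" if "x \<in> C \<union> D" for x i
    proof -
      have "x i \<in> topspace circle" using thread(1) that sub by blast
      then show ?thesis by simp
    qed
    have "norm (c n) = 1" "norm (d n) = 1" "c n \<noteq> d n"
      using on_circle c d nC[OF c(1)] by auto
    from fold_map_exists[OF this \<open>\<eta> > 0\<close>] obtain g \<delta> where
      g: "continuous_map circle circle g" "circle_degree g = 1" and "\<delta> > 0"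
      and near: "\<And>z. norm z = 1 \<Longrightarrow> Re z = 1/2 \<Longrightarrow> dist (g z) (d n) < \<eta>"
        "\<And>z. norm z = 1 \<Longrightarrow> Re z = - 1/2 \<Longrightarrow> dist (g z) (c n) < \<eta>"
      and away: "\<And>z. norm z = 1 \<Longrightarrow> Re z \<le> 1/2 \<Longrightarrow> \<delta> \<le> dist (g z) (c n)"
        "\<And>z. norm z = 1 \<Longrightarrow> - 1/2 \<le> Re z \<Longrightarrow> \<delta> \<le> dist (g z) (d n)"
      by blast
    \<comment> \<open>The tolerance \<open>\<eta>\<close> keeps the real part of \<open>h\<close>
      off 1/2 on \<open>C\<close> and off -1/2 on \<open>D\<close>; the tolerance
      \<open>\<delta>\<close> puts \<open>c\<close> and \<open>d\<close> on the outer sides.\<close>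
    obtain m h where "m \<ge> n" and h: "continuous_map circle circle h"
      and close: "\<And>z. norm z = 1 \<Longrightarrow> dist (g (h z)) (bond (\<lambda>_. circle) f n m z) < min \<delta> \<eta>"
      using absorb[OF g, of "min \<delta> \<eta>" n] \<open>\<delta> > 0\<close> \<open>\<eta> > 0\<close> by (metis min_less_iff_conj)
    define \<phi> where "\<phi> x = Re (h (x m))" for x :: "nat \<Rightarrow> complex"
    have hn: "norm (h (x m)) = 1" if "x \<in> C \<union> D" for x
      using h on_circle[OF that] by (simp add: continuous_map_circle_iff)
    have close': "dist (g (h (x m))) (x n) < \<delta>" "dist (g (h (x m))) (x n) < \<eta>" if x: "x \<in> C \<union> D" for x
    proof -
      have "x \<in> topspace ?T" using x sub by blast
      then have "bond (\<lambda>_. circle) f n m (x m) = x n"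
        by (intro bond_thread[OF \<open>n \<le> m\<close>] thread)
      then show "dist (g (h (x m))) (x n) < \<delta>" "dist (g (h (x m))) (x n) < \<eta>"
        using close[OF on_circle[OF x]] by (metis min_less_iff_conj)+
    qed
    have "continuous_map ?T euclideanreal \<phi>"
    proof -
      have "continuous_map circle euclidean h"
        using h by (simp add: circle_def continuous_map_in_subtopology)
      then have "continuous_map ?T euclidean (h \<circ> (\<lambda>x. x m))"
        by (rule continuous_map_compose[OF continuous_map_inverse_limit_projection])
      then have "continuous_map ?T euclideanreal (Re \<circ> (h \<circ> (\<lambda>x. x m)))"
        by (rule continuous_map_compose) (simp add: continuous_on_Re continuous_on_id)
      moreover have "Re \<circ> (h \<circ> (\<lambda>x. x m)) = \<phi>" by (simp add: fun_eq_iff \<phi>_def)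
      ultimately show ?thesis by simp
    qed
    then have conn: "connected (\<phi> ` C)" "connected (\<phi> ` D)"
      using C D connectedin_continuous_map_image by (fastforce simp: subcontinuum_def)+
    have half_C: "\<phi> x \<noteq> 1/2" if "x \<in> C" for x
    proof
      assume "\<phi> x = 1/2"
      then have "dist (g (h (x m))) (d n) < \<eta>" using near(1) hn that by (simp add: \<phi>_def)
      moreover have "2 * \<eta> \<le> dist (x n) (d n)" using \<eta>2(2)[OF that] \<eta> by simp
      ultimately show False
        using close'(2)[of x] that dist_triangle3[of "x n" "d n" "g (h (x m))"] by auto
    qed
    have half_D: "\<phi> x \<noteq> - 1/2" if "x \<in> D" for x
    proof
      assume "\<phi> x = - 1/2"
      then have "dist (g (h (x m))) (c n) < \<eta>" using near(2) hn that by (simp add: \<phi>_def)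
      moreover have "2 * \<eta> \<le> dist (x n) (c n)" using \<eta>1(2)[OF that] \<eta> by simp
      ultimately show False
        using close'(2)[of x] that dist_triangle3[of "x n" "c n" "g (h (x m))"] by auto
    qed
    \<comment> \<open>Real part at most 1/2 would keep \<open>g (h (c m))\<close> at distance
      \<open>\<delta>\<close> from \<open>c n\<close>, but it is closer.\<close>
    have c_half: "1/2 < \<phi> c"
      using away(1)[of "h (c m)"] hn[of c] close'(1)[of c] c by (force simp: \<phi>_def)
    have d_half: "\<phi> d < - 1/2"
      using away(2)[of "h (d m)"] hn[of d] close'(1)[of d] d by (force simp: \<phi>_def)
    \<comment> \<open>By connectedness a common point would lie on the side of \<open>c\<close>
      because of \<open>C\<close>, and on the side of \<open>d\<close> because of
      \<open>D\<close>.\<close>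
    obtain x where x: "x \<in> C" "x \<in> D" using not by blast
    have "1/2 < \<phi> x"
    proof (rule ccontr)
      assume "\<not> 1/2 < \<phi> x"
      then have "1/2 \<in> \<phi> ` C"
        using c_half x c by (intro connectedD_interval[OF conn(1) imageI imageI, of x c]) auto
      then show False using half_C by (metis imageE)
    qed
    moreover have "\<phi> x < - 1/2"
    proof (rule ccontr)
      assume "\<not> \<phi> x < - 1/2"
      then have "- 1/2 \<in> \<phi> ` D"
        using d_half x d by (intro connectedD_interval[OF conn(2) imageI imageI, of d x]) auto
      then show False using half_D by (metis imageE)
    qed
    ultimately show False by simp
  qed
qed

section \<open>Fraisse sequences of circle maps\<close>

lemma metrizable_space_circle: "metrizable_space circle"
  unfolding circle_def by (simp add: metrizable_space_subtopology metrizable_space_euclidean)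

lemma circle_cat_iff:
  "(X, f, Y) \<in> circle_cat P \<longleftrightarrow>
     X = circle \<and> Y = circle \<and> f \<in> extensional (sphere 0 1) \<and> circle_surjection f \<and>
     circle_degree f \<in> degree_set P"
  by (auto simp: circle_cat_def)

lemma circle_cat_subset_metrizable_compacta: "circle_cat P \<subseteq> metrizable_compacta"
  by (auto simp: circle_cat_def circle_surjection_def
      intro!: metrizable_compactaI compact_space_circle metrizable_space_circle)

lemma restrict_in_circle_cat:
  assumes g: "continuous_map circle circle g" and deg: "circle_degree g \<in> degree_set P"
  shows "(circle, restrict g (sphere 0 1), circle) \<in> circle_cat P"
proof -
  let ?g = "restrict g (sphere 0 1)"
  have "circle_degree ?g = circle_degree g" by (rule circle_degree_cong) simp
  moreover have "continuous_map circle circle ?g"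
    using g by (rule continuous_map_eq) simp
  ultimately show ?thesis
    using deg circle_surjection_if_degree_nonzero[of ?g] by (auto simp: circle_cat_iff degree_set_def)
qed

lemma one_in_degree_set: "1 \<in> degree_set P"
  by (auto simp: degree_set_def)

lemma prime_in_degree_set:
  assumes "p \<in> P" "prime p"
  shows "int p \<in> degree_set P"
  using assms by (auto simp: degree_set_def dest: primes_dvd_imp_eq)

text \<open>\<open>fixed_metric circle\<close> is an arbitrary compatible metric. By compactness the
  identity from it to the Euclidean metric is uniformly continuous, which carries closeness over to
  Euclidean distances.\<close>

lemma approx_maps_circle_dist:
  assumes "\<delta> > 0"
  shows "\<exists>\<epsilon>>0. \<forall>f g. continuous_map circle circle f \<longrightarrow> f \<in> extensional (sphere 0 1) \<longrightarrow>
    continuous_map circle circle g \<longrightarrow> g \<in> extensional (sphere 0 1) \<longrightarrow>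
    approx_maps circle circle \<epsilon> f g \<longrightarrow> (\<forall>z. norm z = 1 \<longrightarrow> dist (f z) (g z) < \<delta>)"
proof -
  let ?m = "fixed_metric circle"
  have top: "mtopology_of ?m = circle"
    by (rule mtopology_of_fixed_metric[OF metrizable_space_circle])
  then have space: "mspace ?m = sphere 0 1"
    by (metis topspace_circle topspace_mtopology_of)
  have "continuous_map circle euclidean (\<lambda>z. z)"
    by (simp add: circle_def)
  then have "uniformly_continuous_map ?m euclidean_metric (\<lambda>z. z)"
    using continuous_eq_uniformly_continuous_map[of ?m euclidean_metric "\<lambda>z. z"] compact_space_circle
    by (simp add: top)
  then obtain \<epsilon> where \<epsilon>: "\<epsilon> > 0"
    "\<And>x y. norm x = 1 \<Longrightarrow> norm y = 1 \<Longrightarrow> mdist ?m y x < \<epsilon> \<Longrightarrow> dist y x < \<delta>"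
    using assms unfolding uniformly_continuous_map_def space by auto
  have "dist (f z) (g z) < \<delta>"
    if "continuous_map circle circle f" "f \<in> extensional (sphere 0 1)"
      "continuous_map circle circle g" "g \<in> extensional (sphere 0 1)"
      "approx_maps circle circle \<epsilon> f g" "norm z = 1" for f g z
  proof -
    have "f \<in> mspace (hom_metric circle circle)" "g \<in> mspace (hom_metric circle circle)"
      using that by (simp_all add: mspace_hom_metric compact_space_circle metrizable_space_circle)
    moreover have "z \<in> topspace circle" using that(6) by simp
    ultimately have "mdist ?m (f z) (g z) < \<epsilon>"
      using that(5) compact_space_circle cfunspace_mdist_lt[where f = f and g = g]
      unfolding hom_metric_def approx_maps_def compact_space_def by blast
    then show ?thesis
      using \<epsilon>(2) that by (simp add: continuous_map_circle_iff)
  qed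
  then show ?thesis using \<epsilon>(1) by blast
qed

lemma bond_circle:
  assumes f: "\<And>n. continuous_map circle circle (f n)"
  shows "continuous_map circle circle (bond (\<lambda>_. circle) f n m)"
    and "bond (\<lambda>_. circle) f n m \<in> extensional (sphere 0 1)"
    and "n \<le> m \<Longrightarrow> circle_degree (bond (\<lambda>_. circle) f n m) = (\<Prod>i\<in>{n..<m}. circle_degree (f i))"
proof -
  have id_deg: "circle_degree (id_map circle) = 1"
    using circle_degree_power[of 1] circle_degree_cong[of "id_map circle" "\<lambda>z. z ^ 1"]
    by (simp add: id_map_def)
  show cont: "continuous_map circle circle (bond (\<lambda>_. circle) f n m)" for m
    by (induction m) (auto intro: continuous_map_id_map continuous_map_compose_restrict f
        simp del: topspace_circle)
  show "bond (\<lambda>_. circle) f n m \<in> extensional (sphere 0 1)"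
    by (cases m) (auto simp: id_map_def compose_extensional)
  show "circle_degree (bond (\<lambda>_. circle) f n m) = (\<Prod>i\<in>{n..<m}. circle_degree (f i))" if "n \<le> m"
    using that
  proof (induction m)
    case (Suc m)
    show ?case
    proof (cases "n \<le> m")
      case True
      have "circle_degree (bond (\<lambda>_. circle) f n (Suc m)) = circle_degree (bond (\<lambda>_. circle) f n m \<circ> f m)"
        using True by (intro circle_degree_cong) (simp add: compose_def)
      then show ?thesis
        using True Suc.IH by (simp add: circle_degree_compose cont f)
    next
      case False
      then have "n = Suc m" using Suc.prems by simp
      then show ?thesis by (simp add: id_deg)
    qed
  qed (simp add: id_deg)
qed

text \<open>Absorption in Euclidean terms, for a plain map \<open>g\<close> freed from the
  extensionality that arrows require.\<close>

lemma fraisse_absorbing_circle: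
  assumes seq: "cat_seq (circle_cat P) (\<lambda>_. circle) f"
    and abs: "fraisse_absorbing (circle_cat P) (\<lambda>_. circle) f"
    and g: "continuous_map circle circle g" "circle_degree g \<in> degree_set P" and "\<delta> > 0"
  shows "\<exists>m\<ge>n. \<exists>h. continuous_map circle circle h \<and>
    (\<forall>z. norm z = 1 \<longrightarrow> dist (g (h z)) (bond (\<lambda>_. circle) f n m z) < \<delta>)"
proof -
  let ?g = "restrict g (sphere 0 1)"
  have f: "continuous_map circle circle (f n)" for n
    using seq by (simp add: cat_seq_def circle_cat_iff circle_surjection_def)
  obtain \<epsilon> where "\<epsilon> > 0" and \<epsilon>: "\<And>u v. continuous_map circle circle u \<Longrightarrow> u \<in> extensional (sphere 0 1) \<Longrightarrow>
      continuous_map circle circle v \<Longrightarrow> v \<in> extensional (sphere 0 1) \<Longrightarrow>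
      approx_maps circle circle \<epsilon> u v \<Longrightarrow> \<forall>z. norm z = 1 \<longrightarrow> dist (u z) (v z) < \<delta>"
    using approx_maps_circle_dist[OF \<open>\<delta> > 0\<close>] by blast
  have "(circle, ?g, circle) \<in> circle_cat P" by (rule restrict_in_circle_cat[OF g])
  then obtain m h where m: "m \<ge> n" and h: "(circle, h, circle) \<in> circle_cat P"
    and approx: "approx_maps circle circle \<epsilon> (compose (sphere 0 1) ?g h) (bond (\<lambda>_. circle) f n m)"
    using abs \<open>\<epsilon> > 0\<close> unfolding fraisse_absorbing_def topspace_circle by blast
  have hc: "continuous_map circle circle h"
    using h by (simp add: circle_cat_iff circle_surjection_def)
  have gc: "continuous_map circle circle ?g" using g(1) by (rule continuous_map_eq) simp
  have "continuous_map circle circle (compose (sphere 0 1) ?g h)"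
    using continuous_map_compose_restrict[OF hc gc] by simp
  then have "\<forall>z. norm z = 1 \<longrightarrow> dist (compose (sphere 0 1) ?g h z) (bond (\<lambda>_. circle) f n m z) < \<delta>"
    by (intro \<epsilon> approx compose_extensional bond_circle f)
  moreover have "compose (sphere 0 1) ?g h z = g (h z)" if "norm z = 1" for z
    using hc that by (simp add: compose_eq continuous_map_circle_iff)
  ultimately show ?thesis using m hc by metis
qed

section \<open>The supernatural type of a Fraisse sequence\<close>

lemma SUP_enat_eq_infinity:
  assumes "\<And>k. \<exists>N. enat k \<le> F N"
  shows "(SUP N. F N) = (\<infinity> :: enat)"
proof (rule ccontr)
  assume "(SUP N. F N) \<noteq> \<infinity>"
  then obtain k where k: "(SUP N. F N) = enat k" by auto
  obtain N where "enat (Suc k) \<le> F N" using assms by blast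
  also have "\<dots> \<le> enat k" unfolding k[symmetric] by (rule SUP_upper) simp
  finally show False by simp
qed

text \<open>Blocks with product divisible by \<open>p\<close> occur arbitrarily late, and each
  contains a degree divisible by \<open>p\<close>, so the partial sums of exponents are
  unbounded.\<close>

lemma degree_product_eq_infinity:
  assumes deg: "\<And>n. circle_degree (u n) \<noteq> 0" and p: "prime p"
    and inf: "\<And>n. \<exists>m\<ge>n. int p dvd (\<Prod>i\<in>{n..<m}. circle_degree (u i))"
  shows "degree_product u n0 p = \<infinity>"
proof -
  let ?a = "\<lambda>i. multiplicity p (nat \<bar>circle_degree (u i)\<bar>)"
  have "\<exists>N\<ge>n0. k \<le> (\<Sum>i\<in>{n0..<N}. ?a i)" for k
  proof (induction k)
    case (Suc k)
    then obtain N where N: "N \<ge> n0" "k \<le> (\<Sum>i\<in>{n0..<N}. ?a i)" by blast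
    obtain m where m: "m \<ge> N" "int p dvd (\<Prod>i\<in>{N..<m}. circle_degree (u i))" using inf by blast
    then obtain i where i: "i \<in> {N..<m}" "int p dvd circle_degree (u i)"
      using p by (auto simp: prime_dvd_prod_iff)
    have "p dvd nat \<bar>circle_degree (u i)\<bar>" using i(2) by (simp add: nat_dvd_iff dvd_nat_abs_iff)
    moreover have "nat \<bar>circle_degree (u i)\<bar> \<noteq> 0" using deg[of i] by simp
    ultimately have "?a i > 0"
      by (metis p prime_imp_prime_elem prime_multiplicity_gt_zero_iff)
    then have "1 \<le> (\<Sum>i\<in>{N..<m}. ?a i)"
      using i(1) member_le_sum[of i "{N..<m}" ?a] by simp
    moreover have "(\<Sum>i\<in>{n0..<m}. ?a i) = (\<Sum>i\<in>{n0..<N}. ?a i) + (\<Sum>i\<in>{N..<m}. ?a i)"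
      using N(1) m(1) by (simp add: sum.atLeastLessThan_concat)
    ultimately show ?case using N m(1) by (intro exI[of _ m]) simp
  qed auto
  moreover have "(\<Sum>i\<in>{n0..<N}. enat (?a i)) = enat (\<Sum>i\<in>{n0..<N}. ?a i)" for N
    by (simp flip: of_nat_eq_enat)
  ultimately show ?thesis
    unfolding degree_product_def by (intro SUP_enat_eq_infinity) (metis enat_ord_simps(1))
qed

lemma degree_product_eq_0:
  assumes "\<And>n. \<not> int p dvd circle_degree (u n)"
  shows "degree_product u n0 p = 0"
proof -
  have "multiplicity p (nat \<bar>circle_degree (u i)\<bar>) = 0" for i
    using assms[of i] by (intro not_dvd_imp_multiplicity_0) (simp add: nat_dvd_iff dvd_nat_abs_iff)
  then show ?thesis by (simp add: degree_product_def flip: zero_enat_def)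
qed

lemma supernatural_class_cong:
  assumes "\<And>p. prime p \<Longrightarrow> s p = t p"
  shows "supernatural_class s = supernatural_class t"
proof -
  have "{p. prime p \<and> s p = \<infinity>} = {p. prime p \<and> t p = \<infinity>}" using assms by auto
  moreover have "{p. prime p \<and> s p \<noteq> r p} = {p. prime p \<and> t p \<noteq> r p}" for r using assms by auto
  ultimately show ?thesis by (simp add: supernatural_class_def supernatural_equiv_def)
qed

lemma sequence_type_fraisse:
  assumes seq: "cat_seq (circle_cat P) (\<lambda>_. circle) f"
    and abs: "fraisse_absorbing (circle_cat P) (\<lambda>_. circle) f"
  shows "sequence_type f = Class_Type (supernatural_class (prime_power_infinity P))"
proof -
  have f: "continuous_map circle circle (f n)" and deg: "circle_degree (f n) \<in> degree_set P" for n
    using seq by (simp_all add: cat_seq_def circle_cat_iff circle_surjection_def)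
  have nz: "circle_degree (f n) \<noteq> 0" for n using deg[of n] by (simp add: degree_set_def)
  have "degree_product f n0 p = prime_power_infinity P p" if p: "prime p" for n0 p
  proof (cases "p \<in> P")
    case True
    have "\<exists>m\<ge>n. int p dvd (\<Prod>i\<in>{n..<m}. circle_degree (f i))" for n
    proof -
      have pow: "continuous_map circle circle (\<lambda>z. z ^ p)"
        by (auto simp: continuous_map_circle_iff norm_power intro!: continuous_intros)
      have "circle_degree (\<lambda>z. z ^ p) \<in> degree_set P"
        using prime_in_degree_set[OF True p] by (simp add: circle_degree_power)
      \<comment> \<open>Tolerance 2 suffices: maps less than 2 apart have equal degrees, so the
        composition of bonding maps has degree \<open>p\<close> times that of
        \<open>h\<close>.\<close>
      from fraisse_absorbing_circle[OF seq abs pow this, of 2 n] obtain m h where m: "m \<ge> n"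
        and h: "continuous_map circle circle h"
        and close: "\<And>z. norm z = 1 \<Longrightarrow> dist (h z ^ p) (bond (\<lambda>_. circle) f n m z) < 2"
        by auto
      have "circle_degree (bond (\<lambda>_. circle) f n m) = circle_degree ((\<lambda>z. z ^ p) \<circ> h)"
        using close by (intro circle_degree_close[symmetric] bond_circle f continuous_map_compose[OF h pow]) simp
      then have "(\<Prod>i\<in>{n..<m}. circle_degree (f i)) = int p * circle_degree h"
        by (simp add: bond_circle(3)[OF f m] circle_degree_compose[OF pow h] circle_degree_power)
      then show ?thesis using m by auto
    qed
    then show ?thesis
      using True degree_product_eq_infinity[OF nz p] by (simp add: prime_power_infinity_def)
  next
    case False
    then have "\<not> int p dvd circle_degree (f n)" for n
      using deg[of n] p by (auto simp: degree_set_def)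
    then show ?thesis using False by (simp add: degree_product_eq_0 prime_power_infinity_def)
  qed
  \<comment> \<open>Holding for every \<open>n0\<close>, this covers whichever index the
    \<open>SOME\<close> in \<open>sequence_type\<close> picks.\<close>
  then have "supernatural_class (degree_product f n0) = supernatural_class (prime_power_infinity P)" for n0
    by (intro supernatural_class_cong)
  then show ?thesis by (simp add: sequence_type_def nz)
qed

theorem theorem5p22:
  fixes P :: "nat set" and U :: "complex topology"
  assumes "P \<subseteq> {p. prime p}"
    and "fraisse_limit (circle_cat P) (sigma_closure (circle_cat P)) U"
  shows "adic_pseudo_solenoid P U"
proof -
  obtain X f q where fr: "fraisse_sequence (circle_cat P) X f"
    and lim: "limit_cone (sigma_closure (circle_cat P)) X f U q"
    using assms(2) unfolding fraisse_limit_def by blast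
  have "X = (\<lambda>_. circle)"
    using fr by (auto simp: fraisse_sequence_def cat_seq_def circle_cat_iff)
  note fr = fr[unfolded this] and lim = lim[unfolded this]
  have seq: "cat_seq (circle_cat P) (\<lambda>_. circle) f"
    and abs: "fraisse_absorbing (circle_cat P) (\<lambda>_. circle) f"
    using fr by (simp_all add: fraisse_sequence_def)
  have surj: "circle_surjection (f n)" for n
    using seq by (simp add: cat_seq_def circle_cat_iff)
  then have f: "continuous_map circle circle (f n)" for n
    by (simp add: circle_surjection_def)
  obtain V r where V: "limit_cone metrizable_compacta (\<lambda>_. circle) f V r"
    and VT: "V homeomorphic_space inverse_limit (\<lambda>_. circle) f"
    using limit_cone_exists[of "\<lambda>_. circle" f] f compact_space_circle metrizable_space_circle by blast
  \<comment> \<open>With \<open>V\<close> a limit in the closure as well, uniqueness of limits there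
    ties \<open>U\<close> to the inverse limit.\<close>
  have "limit_cone (sigma_closure (circle_cat P)) (\<lambda>_. circle) f V r"
    by (rule limit_cone_sigma_closure[OF circle_cat_subset_metrizable_compacta seq V])
  then have "U homeomorphic_space V"
    by (rule limit_cones_homeomorphic[OF circle_cat_subset_metrizable_compacta lim])
  then have UT: "U homeomorphic_space inverse_limit (\<lambda>_. circle) f"
    using VT by (rule homeomorphic_space_trans)
  \<comment> \<open>The Fraisse sequence itself witnesses circle-likeness and serves to read off the
    type.\<close>
  have expansion: "circle_expansion U f"
    using surj UT by (simp add: circle_expansion_def)
  have "hereditarily_indecomposable (inverse_limit (\<lambda>_. circle) f)"
    by (rule hereditarily_indecomposable_inverse_limit[OF f])
      (auto intro!: fraisse_absorbing_circle[OF seq abs] simp: one_in_degree_set)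
  then have "hereditarily_indecomposable U"
    by (rule hereditarily_indecomposable_homeomorphic[OF UT])
  then show ?thesis
    using expansion sequence_type_fraisse[OF seq abs]
    by (auto simp: adic_pseudo_solenoid_def pseudo_solenoid_def circle_like_def has_type_def)
qed

end
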